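(* Let $n\ge 2$ and let $S\in C^1(\mathbb R^n\times\mathcal S^{n\times n})$ be such that the matrix $\left(-\frac{\partial S}{\partial M_{ij}}(p,M)\right)$ is positive definite for all $(p,M)\in\mathbb R^n\times\mathcal S^{n\times n}$. Let $\beta\in\mathbb R\setminus\{0\}$ and $$T(t,p,M):=S\left(t^{-\frac{1+\beta}{\beta}}p,\ t^{-\frac{2+\beta}{\beta}}M\right),\qquad (t,p,M)\in\mathbb R_+\times\mathbb R^n\times\mathcal S^{n\times n}.$$ If $-1<\beta<0$, assume further that $S(p,0)\ge 0$ for all $p\in\mathbb R^n$. Assume that $u\in C^2(B_2\setminus\{0\})$ and $v\in C^2(B_2)$ satisfy $$v>0\ \text{ in } B_2,\qquad u>v\ \text{ in } B_2\setminus\{0\},\qquad \Delta u\le 0\ \text{ in } B_2\setminus\{0\},$$ $$T(u,\nabla u,\nabla^2u)\ge 0\ge T(v,\nabla v,\nabla^2v)\qquad\text{in } B_2\setminus\{0\}.$$ Then $$\liminf_{|x|\to 0}[u(x)-v(x)]>0 .$$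
   Context: $\mathbb R_+=(0,\infty)$; $\mathcal S^{n\times n}$ is the set of real symmetric $n\times n$ matrices; $B_a\subset\mathbb R^n$ is the ball of radius $a$ centered at the origin. *)

theory Defs
  imports "HOL-Analysis.Analysis"
begin

definition sym_matrices :: "(real^'n^'n) set" where
  "sym_matrices = {M. transpose M = M}"

(* Used for open sets X, where "at x within X" is "at x", and for linear subspaces X, where
   only the restriction of the derivative to X is determined by f.  Values of f outside X are
   irrelevant. *)
definition C1_on :: "('a::real_normed_vector \<Rightarrow> 'b::real_normed_vector) \<Rightarrow> 'a set \<Rightarrow> bool" where
  "C1_on f X \<longleftrightarrow>
     (\<exists>f' :: 'a \<Rightarrow> 'a \<Rightarrow>\<^sub>L 'b.
        (\<forall>x\<in>X. (f has_derivative blinfun_apply (f' x)) (at x within X)) \<and> continuous_on X f')"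

definition gradient :: "(real^'n \<Rightarrow> real) \<Rightarrow> real^'n \<Rightarrow> real^'n" where
  "gradient f x = (\<chi> i. frechet_derivative f (at x) (axis i 1))"

definition hessian :: "(real^'n \<Rightarrow> real) \<Rightarrow> real^'n \<Rightarrow> real^'n^'n" where
  "hessian f x = jacobian (gradient f) (at x)"

definition laplacian :: "(real^'n \<Rightarrow> real) \<Rightarrow> real^'n \<Rightarrow> real" where
  "laplacian f x = trace (hessian f x)"

(* Meant for open X. *)
definition C2_on :: "(real^'n \<Rightarrow> real) \<Rightarrow> (real^'n) set \<Rightarrow> bool" where
  "C2_on f X \<longleftrightarrow> C1_on f X \<and> C1_on (gradient f) X"

definition sym_unit :: "'n \<Rightarrow> 'n \<Rightarrow> real^'n^'n" where
  "sym_unit i j = (\<chi> k l. ((if k = i \<and> l = j then 1 else 0) + (if k = j \<and> l = i then 1 else 0)) / 2)"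

(* The matrix of partial derivatives of S with respect to the entries M_ij.  As S is only given
   on symmetric matrices, the derivative is taken in the direction of the symmetrised matrix unit
   (the derivative in M_ij of S(p, (M + M^T)/2)).  With this convention the derivative of
   S(p, _) at M in a symmetric direction N is the sum over all i, j of (dS/dM_ij) * N_ij. *)
definition matrix_gradient :: "((real^'n) \<times> (real^'n^'n) \<Rightarrow> real) \<Rightarrow> real^'n \<Rightarrow> real^'n^'n \<Rightarrow> real^'n^'n" where
  "matrix_gradient S p M = (\<chi> i j. deriv (\<lambda>t. S (p, M + t *\<^sub>R sym_unit i j)) 0)"

definition positive_definite :: "real^'n^'n \<Rightarrow> bool" where
  "positive_definite A \<longleftrightarrow> transpose A = A \<and> (\<forall>x. x \<noteq> 0 \<longrightarrow> x \<bullet> (A *v x) > 0)"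

definition T_op :: "((real^'n) \<times> (real^'n^'n) \<Rightarrow> real) \<Rightarrow> real \<Rightarrow> real \<Rightarrow> real^'n \<Rightarrow> real^'n^'n \<Rightarrow> real" where
  "T_op S \<beta> t p M =
     S (t powr (- ((1 + \<beta>) / \<beta>)) *\<^sub>R p, t powr (- ((2 + \<beta>) / \<beta>)) *\<^sub>R M)"

end

theory Submission
  imports Defs
begin

text \<open>
  The idea is that a supersolution \<open>u\<close> above a subsolution \<open>v\<close> is automatically above a tilted copy
  of \<open>v\<close>, and a superharmonic function cannot meet two functions with different gradients at one
  point.

  Fix a vector \<open>e \<noteq> 0\<close>.  By ellipticity, for large \<open>K\<close> the function
  \<open>v + \<epsilon> (e \<bullet> x + K (e \<bullet> x)\<^sup>2)\<close> is a strict subsolution near the origin, for every small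
  \<open>\<epsilon> > 0\<close>.  The added term vanishes at the origin and so cannot push the function above \<open>u\<close>
  there, and contact away from the origin contradicts strictness.  Hence \<open>u\<close> lies above
  this function near the origin (lemma \<open>supersolution_above_tilted_subsolution\<close>).

  Both \<open>v\<close> and its tilted copy have the value \<open>v 0\<close> at the origin, but their gradients differ by
  \<open>\<epsilon> e\<close>.  Their maximum has a convex wedge at the origin, and the mean values of a wedge over small
  spheres exceed its value at the centre by an amount proportional to the radius.  As a
  superharmonic function bounded below does not see an isolated singularity in dimension at least
  two (lemma \<open>superharmonic_punctured_ball_nonneg\<close>), this excess is inherited by the lower limit of
  \<open>u\<close> (lemma \<open>superharmonic_above_two_gradients\<close>), while \<open>v\<close> is continuous.
\<close>

section \<open>Second-order conditions at a minimum\<close>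

text \<open>
  Gradient and second derivative are carried as explicit functions, so that the derivatives of
  sums and differences are again explicit; \<open>D x h \<bullet> h\<close> is the Hessian form, and the
  Laplacian is \<open>\<Sum>b\<in>Basis. D x b \<bullet> b\<close>.
\<close>

definition second_order_on ::
  "('a::euclidean_space \<Rightarrow> real) \<Rightarrow> ('a \<Rightarrow> 'a) \<Rightarrow> ('a \<Rightarrow> 'a \<Rightarrow> 'a) \<Rightarrow> 'a set \<Rightarrow> bool" where
  "second_order_on f g D X \<longleftrightarrow>
     (\<forall>x\<in>X. (f has_derivative (\<lambda>h. g x \<bullet> h)) (at x) \<and> (g has_derivative D x) (at x))"

lemma second_order_onD:
  assumes "second_order_on f g D X" "x \<in> X"
  shows "(f has_derivative (\<lambda>h. g x \<bullet> h)) (at x)" "(g has_derivative D x) (at x)"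
  using assms by (auto simp: second_order_on_def)

lemma second_order_on_subset:
  "second_order_on f g D X \<Longrightarrow> Y \<subseteq> X \<Longrightarrow> second_order_on f g D Y"
  by (auto simp: second_order_on_def)

lemma second_order_on_continuous:
  "second_order_on f g D X \<Longrightarrow> continuous_on X f"
  by (meson has_derivative_continuous continuous_at_imp_continuous_on second_order_onD(1))

lemma second_order_on_add:
  assumes "second_order_on f g D X" "second_order_on f' g' D' X"
  shows "second_order_on (\<lambda>x. f x + f' x) (\<lambda>x. g x + g' x) (\<lambda>x h. D x h + D' x h) X"
  using assms unfolding second_order_on_def
  by (auto simp: inner_add_left fun_eq_iff intro!: has_derivative_eq_rhs[OF has_derivative_add] has_derivative_add)

lemma second_order_on_diff:
  assumes "second_order_on f g D X" "second_order_on f' g' D' X"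
  shows "second_order_on (\<lambda>x. f x - f' x) (\<lambda>x. g x - g' x) (\<lambda>x h. D x h - D' x h) X"
  using assms unfolding second_order_on_def
  by (auto simp: inner_diff_left fun_eq_iff intro!: has_derivative_eq_rhs[OF has_derivative_diff] has_derivative_diff)

lemma second_order_on_scale:
  assumes "second_order_on f g D X"
  shows "second_order_on (\<lambda>x. c * f x) (\<lambda>x. c *\<^sub>R g x) (\<lambda>x h. c *\<^sub>R D x h) X"
  using assms unfolding second_order_on_def
  by (auto simp: fun_eq_iff intro!: has_derivative_eq_rhs[OF has_derivative_mult_right] has_derivative_scaleR_right)

lemma line_derivative:
  fixes g :: "'a::euclidean_space \<Rightarrow> 'a"
  assumes "(f has_derivative (\<lambda>h. g (x + t *\<^sub>R a) \<bullet> h)) (at (x + t *\<^sub>R a))"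
  shows "((\<lambda>s. f (x + s *\<^sub>R a)) has_real_derivative g (x + t *\<^sub>R a) \<bullet> a) (at t)"
proof -
  have "((\<lambda>s. x + s *\<^sub>R a) has_derivative (\<lambda>s. s *\<^sub>R a)) (at t)"
    by (auto intro!: derivative_eq_intros)
  then have "((\<lambda>s. f (x + s *\<^sub>R a)) has_derivative (\<lambda>s. g (x + t *\<^sub>R a) \<bullet> (s *\<^sub>R a))) (at t)"
    using has_derivative_compose assms by blast
  then show ?thesis
    by (simp add: has_field_derivative_def mult_commute_abs)
qed

lemma local_min_second_order:
  assumes so: "second_order_on f g D X" and "open X" and x: "x \<in> X"
    and min: "\<And>y. y \<in> X \<Longrightarrow> f x \<le> f y"
  shows "g x = 0" and "0 \<le> D x h \<bullet> h"
proof -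
  have "(\<lambda>h. g x \<bullet> h) = (\<lambda>h. 0)"
    by (rule differential_zero_maxmin[OF x \<open>open X\<close> second_order_onD(1)[OF so x]]) (use min in auto)
  then have "g x \<bullet> g x = 0"
    by metis
  then show g0: "g x = 0"
    by simp
  show "0 \<le> D x h \<bullet> h"
  proof (rule ccontr)
    assume neg: "\<not> 0 \<le> D x h \<bullet> h"
    have lin: "((\<lambda>t. x + t *\<^sub>R h) has_derivative (\<lambda>t. t *\<^sub>R h)) (at 0)"
      by (auto intro!: derivative_eq_intros)
    have "((\<lambda>t. g (x + t *\<^sub>R h) \<bullet> h) has_derivative (\<lambda>t. D x (t *\<^sub>R h) \<bullet> h)) (at 0)"
      by (intro has_derivative_inner_left has_derivative_compose[OF lin]) (use second_order_onD(2)[OF so x] in simp)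
    moreover have "D x (t *\<^sub>R h) = t *\<^sub>R D x h" for t
      using has_derivative_linear[OF second_order_onD(2)[OF so x]] by (simp add: linear_cmul)
    ultimately have d: "((\<lambda>t. g (x + t *\<^sub>R h) \<bullet> h) has_real_derivative D x h \<bullet> h) (at 0)"
      by (simp add: has_field_derivative_def mult_commute_abs)
    obtain d1 where d1: "d1 > 0" "\<And>t. 0 < t \<Longrightarrow> t < d1 \<Longrightarrow> g (x + t *\<^sub>R h) \<bullet> h < 0"
      using DERIV_neg_dec_right[OF d] neg g0 by auto
    have "((\<lambda>t. x + t *\<^sub>R h) \<longlongrightarrow> x + 0 *\<^sub>R h) (at 0)"
      by (intro tendsto_intros)
    then have "\<forall>\<^sub>F t in at (0::real). x + t *\<^sub>R h \<in> X"
      using \<open>open X\<close> x by (auto dest: topological_tendstoD)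
    then obtain d2 where d2: "d2 > 0" "\<And>t. t \<noteq> 0 \<Longrightarrow> \<bar>t\<bar> < d2 \<Longrightarrow> x + t *\<^sub>R h \<in> X"
      by (auto simp: eventually_at)
    define t where "t = min d1 d2 / 2"
    have t: "0 < t" "t < d1" "t < d2"
      using d1 d2 by (auto simp: t_def)
    have inX: "x + s *\<^sub>R h \<in> X" if "0 \<le> s" "s \<le> t" for s
      using d2(2)[of s] that t x by (cases "s = 0") auto
    have "\<exists>z>0. z < t \<and> f (x + t *\<^sub>R h) - f (x + 0 *\<^sub>R h) = (t - 0) * (g (x + z *\<^sub>R h) \<bullet> h)"
      by (rule MVT2[OF t(1)]) (use line_derivative second_order_onD(1)[OF so inX] in blast)
    then obtain z where z: "0 < z" "z < t" "f (x + t *\<^sub>R h) - f x = t * (g (x + z *\<^sub>R h) \<bullet> h)"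
      by auto
    then have "f (x + t *\<^sub>R h) < f x"
      using d1(2)[of z] t by (smt (verit) mult_pos_neg)
    then show False
      using min[OF inX[of t]] t by simp
  qed
qed

text \<open>
  The mean value theorem for \<open>s \<mapsto> f (x + t b + s a) - f (x + s a)\<close> turns the second difference
  into \<open>t\<close> times an increment of the gradient in direction \<open>a\<close>; both gradient values are then
  expanded around \<open>x\<close>, where the gradient is differentiable.
\<close>

lemma second_difference_approx:
  assumes so: "second_order_on f g D X" and "open X" and x: "x \<in> X" and "0 < \<epsilon>"
  shows "\<exists>d>0. \<forall>t. 0 < t \<and> t < d \<longrightarrow>
    \<bar>f (x + t *\<^sub>R a + t *\<^sub>R b) - f (x + t *\<^sub>R a) - f (x + t *\<^sub>R b) + f x - t\<^sup>2 * (D x b \<bullet> a)\<bar> \<le> \<epsilon> * t\<^sup>2"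
proof -
  have lin: "linear (D x)"
    using has_derivative_linear[OF second_order_onD(2)[OF so x]] .
  define k where "k = (2 * norm a + norm b) * norm a + 1"
  have k: "k > 0"
    by (auto simp: k_def intro!: add_nonneg_pos mult_nonneg_nonneg)
  define \<eta> where "\<eta> = \<epsilon> / k"
  have \<eta>: "\<eta> > 0" "\<eta> * ((2 * norm a + norm b) * norm a) \<le> \<epsilon>"
    using k \<open>0 < \<epsilon>\<close> by (auto simp: \<eta>_def k_def field_simps)
  obtain d1 where d1: "d1 > 0" "\<And>y. norm (y - x) < d1 \<Longrightarrow> norm (g y - g x - D x (y - x)) \<le> \<eta> * norm (y - x)"
    using second_order_onD(2)[OF so x] \<eta>(1) unfolding has_derivative_at_alt by metis
  obtain d2 where d2: "d2 > 0" "ball x d2 \<subseteq> X"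
    using \<open>open X\<close> x openE by blast
  define d where "d = min d1 d2 / (norm a + norm b + 1)"
  have np: "norm a + norm b + 1 > 0"
    by (smt (verit) norm_ge_zero)
  have d: "d > 0"
    using d1 d2 np by (simp add: d_def)
  show ?thesis
  proof (intro exI[of _ d] conjI d allI impI, elim conjE)
    fix t :: real assume t: "0 < t" "t < d"
    have td: "t * (norm a + norm b + 1) < min d1 d2"
      using t np by (simp add: d_def field_simps)
    have small: "norm (s *\<^sub>R a + r *\<^sub>R b) < d1" "x + s *\<^sub>R a + r *\<^sub>R b \<in> X"
      if "0 \<le> s" "s \<le> t" "0 \<le> r" "r \<le> t" for s r
    proof -
      have "norm (s *\<^sub>R a + r *\<^sub>R b) \<le> s * norm a + r * norm b"
        using norm_triangle_ineq[of "s *\<^sub>R a" "r *\<^sub>R b"] that by simp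
      also have "\<dots> \<le> t * norm a + t * norm b"
        using that by (intro add_mono mult_right_mono) auto
      also have "\<dots> < min d1 d2"
        using td t by (simp add: algebra_simps)
      finally have *: "norm (s *\<^sub>R a + r *\<^sub>R b) < min d1 d2" .
      then show "norm (s *\<^sub>R a + r *\<^sub>R b) < d1" by simp
      have "dist x (x + s *\<^sub>R a + r *\<^sub>R b) = norm (s *\<^sub>R a + r *\<^sub>R b)"
        unfolding dist_commute[of x] by (simp add: dist_norm add.assoc)
      then have "x + s *\<^sub>R a + r *\<^sub>R b \<in> ball x d2"
        using * by simp
      then show "x + s *\<^sub>R a + r *\<^sub>R b \<in> X" using d2 by blast
    qed
    let ?\<phi> = "\<lambda>s. f ((x + t *\<^sub>R b) + s *\<^sub>R a) - f (x + s *\<^sub>R a)"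
    have "\<exists>z>0. z < t \<and> ?\<phi> t - ?\<phi> 0 = (t - 0) * (g ((x + t *\<^sub>R b) + z *\<^sub>R a) \<bullet> a - g (x + z *\<^sub>R a) \<bullet> a)"
    proof (rule MVT2[OF t(1)])
      fix s assume s: "0 \<le> s" "s \<le> t"
      have "x + s *\<^sub>R a \<in> X" "x + t *\<^sub>R b + s *\<^sub>R a \<in> X"
        using small(2)[OF s, of 0] small(2)[OF s, of t] t by (auto simp: algebra_simps)
      then show "(?\<phi> has_real_derivative (g ((x + t *\<^sub>R b) + s *\<^sub>R a) \<bullet> a - g (x + s *\<^sub>R a) \<bullet> a)) (at s)"
        by (intro DERIV_diff line_derivative second_order_onD(1)[OF so])
    qed
    then obtain z where z: "0 < z" "z < t"
      and eq: "?\<phi> t - ?\<phi> 0 = t * (g ((x + t *\<^sub>R b) + z *\<^sub>R a) \<bullet> a - g (x + z *\<^sub>R a) \<bullet> a)"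
      by auto
    define A B where "A = g ((x + t *\<^sub>R b) + z *\<^sub>R a) - g x - D x (z *\<^sub>R a + t *\<^sub>R b)"
      and "B = g (x + z *\<^sub>R a) - g x - D x (z *\<^sub>R a)"
    have A: "norm A \<le> \<eta> * norm (z *\<^sub>R a + t *\<^sub>R b)"
      using d1(2)[of "(x + t *\<^sub>R b) + z *\<^sub>R a"] small(1)[of z t] z t
      by (simp add: A_def algebra_simps)
    have B: "norm B \<le> \<eta> * norm (z *\<^sub>R a)"
      using d1(2)[of "x + z *\<^sub>R a"] small(1)[of z 0] z t by (simp add: B_def)
    have "norm (z *\<^sub>R a + t *\<^sub>R b) \<le> t * norm a + t * norm b"
      using norm_triangle_ineq[of "z *\<^sub>R a" "t *\<^sub>R b"] z mult_right_mono[of z t "norm a"] by simp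
    moreover have "norm (z *\<^sub>R a) \<le> t * norm a"
      using z mult_right_mono[of z t "norm a"] by simp
    ultimately have "norm A \<le> \<eta> * (t * norm a + t * norm b)" "norm B \<le> \<eta> * (t * norm a)"
      using A B \<eta>(1) by (meson order_trans mult_left_mono less_imp_le)+
    then have AB: "norm (A - B) \<le> \<eta> * (t * (2 * norm a + norm b))"
      using norm_triangle_ineq4[of A B] by (simp add: algebra_simps)
    have "?\<phi> t - ?\<phi> 0 - t\<^sup>2 * (D x b \<bullet> a) = t * ((A - B) \<bullet> a)"
      unfolding eq A_def B_def
      by (simp add: linear_add[OF lin] linear_cmul[OF lin] inner_diff_left inner_add_left power2_eq_square algebra_simps)
    moreover have "\<bar>t * ((A - B) \<bullet> a)\<bar> \<le> \<epsilon> * t\<^sup>2"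
    proof -
      have "\<bar>(A - B) \<bullet> a\<bar> \<le> \<eta> * (t * (2 * norm a + norm b)) * norm a"
        using Cauchy_Schwarz_ineq2[of "A - B" a] mult_right_mono[OF AB, of "norm a"] by simp
      then have "t * \<bar>(A - B) \<bullet> a\<bar> \<le> t * (\<eta> * (t * (2 * norm a + norm b)) * norm a)"
        using t by (intro mult_left_mono) auto
      also have "\<dots> = t\<^sup>2 * (\<eta> * ((2 * norm a + norm b) * norm a))"
        by (simp add: power2_eq_square)
      also have "\<dots> \<le> t\<^sup>2 * \<epsilon>"
        using \<eta>(2) by (intro mult_left_mono) auto
      finally show ?thesis using t by (simp add: abs_mult mult.commute)
    qed
    ultimately show "\<bar>f (x + t *\<^sub>R a + t *\<^sub>R b) - f (x + t *\<^sub>R a) - f (x + t *\<^sub>R b) + f x - t\<^sup>2 * (D x b \<bullet> a)\<bar> \<le> \<epsilon> * t\<^sup>2"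
      by (simp add: algebra_simps)
  qed
qed

text \<open>
  The second difference is symmetric in \<open>a\<close> and \<open>b\<close>, so its two limits agree.  Symmetry matters
  because the ellipticity hypothesis speaks of symmetric matrices only.
\<close>

lemma second_derivative_symmetric:
  assumes so: "second_order_on f g D X" and "open X" and x: "x \<in> X"
  shows "D x a \<bullet> b = D x b \<bullet> a"
proof (rule ccontr)
  assume ne: "D x a \<bullet> b \<noteq> D x b \<bullet> a"
  define \<epsilon> where "\<epsilon> = \<bar>D x a \<bullet> b - D x b \<bullet> a\<bar> / 3"
  have \<epsilon>: "\<epsilon> > 0"
    using ne by (simp add: \<epsilon>_def)
  obtain d1 where d1: "d1 > 0" "\<And>t. 0 < t \<Longrightarrow> t < d1 \<Longrightarrow>
    \<bar>f (x + t *\<^sub>R a + t *\<^sub>R b) - f (x + t *\<^sub>R a) - f (x + t *\<^sub>R b) + f x - t\<^sup>2 * (D x b \<bullet> a)\<bar> \<le> \<epsilon> * t\<^sup>2"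
    using second_difference_approx[OF so \<open>open X\<close> x \<epsilon>] by metis
  obtain d2 where d2: "d2 > 0" "\<And>t. 0 < t \<Longrightarrow> t < d2 \<Longrightarrow>
    \<bar>f (x + t *\<^sub>R b + t *\<^sub>R a) - f (x + t *\<^sub>R b) - f (x + t *\<^sub>R a) + f x - t\<^sup>2 * (D x a \<bullet> b)\<bar> \<le> \<epsilon> * t\<^sup>2"
    using second_difference_approx[OF so \<open>open X\<close> x \<epsilon>] by metis
  define t where "t = min d1 d2 / 2"
  have t: "0 < t" "t < d1" "t < d2"
    using d1 d2 by (auto simp: t_def)
  have sw: "x + t *\<^sub>R b + t *\<^sub>R a = x + t *\<^sub>R a + t *\<^sub>R b"
    by (simp add: algebra_simps)
  have "\<bar>t\<^sup>2 * (D x a \<bullet> b) - t\<^sup>2 * (D x b \<bullet> a)\<bar> \<le> 2 * (\<epsilon> * t\<^sup>2)"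
    using d1(2)[OF t(1,2)] d2(2)[OF t(1,3)] unfolding sw by linarith
  then have "t\<^sup>2 * \<bar>D x a \<bullet> b - D x b \<bullet> a\<bar> \<le> t\<^sup>2 * (2 * \<epsilon>)"
    unfolding right_diff_distrib[symmetric] abs_mult by (simp add: mult_ac)
  then have "\<bar>D x a \<bullet> b - D x b \<bullet> a\<bar> \<le> 2 * \<epsilon>"
    using t by simp
  then show False
    using \<epsilon> by (simp add: \<epsilon>_def)
qed

section \<open>Superharmonic functions on a punctured ball\<close>

text \<open>
  Far from the origin compactness gives a minimum, near the origin the values are too large to
  compete, and the sphere is excluded by the sign.  The maximum principle and the comparison
  with the tilted subsolution both start from this minimum.
\<close>

lemma punctured_ball_negative_minimum:
  fixes w :: "'a::euclidean_space \<Rightarrow> real"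
  assumes cont: "continuous_on (cball 0 r - {0}) w"
    and sphere: "\<And>x. norm x = r \<Longrightarrow> 0 \<le> w x"
    and z: "z \<noteq> 0" "norm z \<le> r" "w z < 0"
    and near0: "\<forall>\<^sub>F x in at 0. w z < w x"
  obtains y where "0 < norm y" "norm y < r" "w y < 0"
    and "\<And>x. x \<noteq> 0 \<Longrightarrow> norm x \<le> r \<Longrightarrow> w y \<le> w x"
proof -
  obtain d where d: "d > 0" "\<And>x. x \<noteq> 0 \<Longrightarrow> norm x < d \<Longrightarrow> w z < w x"
    using near0 by (auto simp: eventually_at)
  define \<rho> where "\<rho> = min d (norm z)"
  define K where "K = cball 0 r - ball (0::'a) \<rho>"
  have \<rho>: "\<rho> > 0"
    using d z by (simp add: \<rho>_def)
  have "compact K"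
    by (auto simp: K_def intro: compact_diff)
  moreover have "z \<in> K"
    using z by (simp add: K_def \<rho>_def)
  moreover have "continuous_on K w"
    using \<rho> by (intro continuous_on_subset[OF cont]) (auto simp: K_def)
  ultimately obtain y where y: "y \<in> K" "\<And>x. x \<in> K \<Longrightarrow> w y \<le> w x"
    using continuous_attains_inf[of K w] by auto
  have yz: "w y \<le> w z"
    using y \<open>z \<in> K\<close> by blast
  show ?thesis
  proof (rule that)
    show "0 < norm y"
      using y(1) \<rho> by (auto simp: K_def)
    show "w y < 0"
      using yz z by simp
    then show "norm y < r"
      using sphere[of y] y(1) by (force simp: K_def)
    show "w y \<le> w x" if "x \<noteq> 0" "norm x \<le> r" for x
    proof (cases "x \<in> K")
      case False
      then show ?thesis
        using d(2)[of x] yz that by (auto simp: K_def \<rho>_def)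
    qed (use y in blast)
  qed
qed

lemma minus_log_norm_second_order:
  "second_order_on (\<lambda>x::'a::euclidean_space. - ln (norm x)) (\<lambda>x. - (1 / (x \<bullet> x)) *\<^sub>R x)
     (\<lambda>x h. - (1 / (x \<bullet> x)) *\<^sub>R h + (2 * (x \<bullet> h) / (x \<bullet> x)\<^sup>2) *\<^sub>R x) (- {0})"
  unfolding second_order_on_def
proof (intro ballI conjI)
  fix x :: 'a assume "x \<in> - {0}"
  then have x: "x \<noteq> 0" "x \<bullet> x \<noteq> 0" "x \<bullet> x > 0" by auto
  have "((\<lambda>x. - (ln (x \<bullet> x) / 2)) has_derivative (\<lambda>h. (- (1 / (x \<bullet> x)) *\<^sub>R x) \<bullet> h)) (at x)"
    using x by (auto intro!: derivative_eq_intros simp: fun_eq_iff inner_commute field_simps)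
  moreover have "- (ln (x \<bullet> x) / 2) = - ln (norm x)" for x :: 'a
    by (simp add: norm_eq_sqrt_inner ln_sqrt)
  ultimately show "((\<lambda>x. - ln (norm x)) has_derivative (\<lambda>h. (- (1 / (x \<bullet> x)) *\<^sub>R x) \<bullet> h)) (at x)"
    by simp
  show "((\<lambda>x. - (1 / (x \<bullet> x)) *\<^sub>R x) has_derivative
    (\<lambda>h. - (1 / (x \<bullet> x)) *\<^sub>R h + (2 * (x \<bullet> h) / (x \<bullet> x)\<^sup>2) *\<^sub>R x)) (at x)"
    using x by (auto intro!: derivative_eq_intros simp: fun_eq_iff inner_commute power2_eq_square divide_simps)
qed

lemma quadratic_second_order:
  fixes p q :: "'a::euclidean_space"
  shows "second_order_on (\<lambda>x. a + p \<bullet> x + b * (q \<bullet> x)\<^sup>2 + c * (x \<bullet> x))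
     (\<lambda>x. p + (2 * b * (q \<bullet> x)) *\<^sub>R q + (2 * c) *\<^sub>R x)
     (\<lambda>x h. (2 * b * (q \<bullet> h)) *\<^sub>R q + (2 * c) *\<^sub>R h) X"
  unfolding second_order_on_def
  by (auto intro!: derivative_eq_intros simp: fun_eq_iff algebra_simps inner_commute)

lemma trace_rank_one:
  "(\<Sum>b\<in>Basis. ((q \<bullet> b) *\<^sub>R r) \<bullet> b) = q \<bullet> (r :: 'a::euclidean_space)"
  by (subst (3) euclidean_inner) simp

text \<open>
  A point has capacity zero in dimension at least two.  The barrier
  \<open>ln r - ln (norm x) + r\<^sup>2 - (norm x)\<^sup>2\<close> vanishes on the sphere, tends to infinity at the origin
  and is strictly superharmonic: the logarithm contributes \<open>(2 - n) / (norm x)\<^sup>2 \<le> 0\<close> and the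
  quadratic \<open>- 2 n\<close>.  After a small multiple of it is added, a negative value would force an
  interior minimum, where the Laplacian cannot be negative.
\<close>

lemma superharmonic_punctured_ball_nonneg:
  fixes w :: "'a::euclidean_space \<Rightarrow> real"
  assumes dim: "DIM('a) \<ge> 2"
    and so: "second_order_on w g D (ball 0 R - {0})"
    and superharmonic: "\<And>x. x \<in> ball 0 R - {0} \<Longrightarrow> (\<Sum>b\<in>Basis. D x b \<bullet> b) \<le> 0"
    and r: "r < R"
    and sphere: "\<And>x. norm x = r \<Longrightarrow> 0 \<le> w x"
    and below: "\<And>x. x \<noteq> 0 \<Longrightarrow> norm x \<le> r \<Longrightarrow> C \<le> w x"
    and z: "z \<noteq> 0" "norm z \<le> r"
  shows "0 \<le> w z"
proof (rule ccontr)
  assume "\<not> 0 \<le> w z"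
  then have neg: "w z < 0" by simp
  have "r > 0"
    using z by (smt (verit) zero_less_norm_iff)
  define B where "B = (\<lambda>x::'a. - ln (norm x) + (ln r + r\<^sup>2 + 0 \<bullet> x + 0 * (0 \<bullet> x)\<^sup>2 + (- 1) * (x \<bullet> x)))"
  have B_eq: "B x = (ln r - ln (norm x)) + (r\<^sup>2 - (norm x)\<^sup>2)" for x
    by (simp add: B_def power2_norm_eq_inner)
  have "B z \<ge> 0"
    using z \<open>r > 0\<close> by (auto simp: B_eq intro!: add_nonneg_nonneg power_mono)
  define \<epsilon> where "\<epsilon> = - w z / (2 * (B z + 1))"
  have \<epsilon>: "\<epsilon> > 0" "w z + \<epsilon> * B z < 0"
    using neg \<open>B z \<ge> 0\<close> mult_neg_pos[of "w z" "B z + 2"] by (auto simp: \<epsilon>_def field_simps)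
  let ?W = "\<lambda>x. w x + \<epsilon> * B x"
  have soB: "second_order_on B (\<lambda>x. - (1 / (x \<bullet> x)) *\<^sub>R x + (0 + (2 * 0 * (0 \<bullet> x)) *\<^sub>R 0 + (2 * - 1) *\<^sub>R x))
     (\<lambda>x h. (- (1 / (x \<bullet> x)) *\<^sub>R h + (2 * (x \<bullet> h) / (x \<bullet> x)\<^sup>2) *\<^sub>R x) + ((2 * 0 * (0 \<bullet> h)) *\<^sub>R 0 + (2 * - 1) *\<^sub>R h)) (ball 0 R - {0})"
    unfolding B_def
    by (intro second_order_on_add quadratic_second_order second_order_on_subset[OF minus_log_norm_second_order]) auto
  note soW = second_order_on_add[OF so second_order_on_scale[OF soB, of \<epsilon>]]
  have "filterlim (\<lambda>x::'a. ln (norm x)) at_bot (at 0)"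
    by (rule filterlim_compose[OF ln_at_0]) (auto simp: filterlim_at eventually_at intro!: tendsto_eq_intros exI[of _ 1])
  then have "\<forall>\<^sub>F x::'a in at 0. ln (norm x) < ln r + C / \<epsilon>"
    by (auto simp: filterlim_at_bot_dense)
  moreover have "\<forall>\<^sub>F x::'a in at 0. x \<noteq> 0 \<and> norm x \<le> r"
    using \<open>r > 0\<close> by (auto simp: eventually_at intro!: exI[of _ r])
  ultimately have near0: "\<forall>\<^sub>F x in at 0. w z + \<epsilon> * B z < ?W x"
  proof eventually_elim
    case (elim x)
    have "(norm x)\<^sup>2 \<le> r\<^sup>2"
      using elim by (intro power_mono) auto
    then have "- (C / \<epsilon>) < B x"
      using elim by (simp add: B_eq)
    then have "- C < \<epsilon> * B x"
      using \<epsilon>(1) by (simp add: field_simps)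
    then show ?case
      using below[of x] elim \<epsilon>(2) by linarith
  qed
  have cont: "continuous_on (cball 0 r - {0}) ?W"
    by (rule continuous_on_subset[OF second_order_on_continuous[OF soW]]) (use r in auto)
  have sphereW: "0 \<le> ?W x" if "norm x = r" for x
    using sphere[OF that] that by (simp add: B_eq)
  obtain y where y: "0 < norm y" "norm y < r"
    and ymin: "\<And>x. x \<noteq> 0 \<Longrightarrow> norm x \<le> r \<Longrightarrow> ?W y \<le> ?W x"
    using punctured_ball_negative_minimum[OF cont sphereW z \<epsilon>(2) near0] by blast
  have sub: "ball 0 r - {0} \<subseteq> ball 0 R - {0::'a}" using r by auto
  have hess: "0 \<le> (D y b + \<epsilon> *\<^sub>R ((- (1 / (y \<bullet> y)) *\<^sub>R b + (2 * (y \<bullet> b) / (y \<bullet> y)\<^sup>2) *\<^sub>R y)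
       + ((2 * 0 * (0 \<bullet> b)) *\<^sub>R 0 + (2 * - 1) *\<^sub>R b))) \<bullet> b" for b
    by (rule local_min_second_order(2)[OF second_order_on_subset[OF soW sub], of y])
      (use y ymin in \<open>auto simp: less_imp_le\<close>)
  have yy: "y \<bullet> y > 0" using y by simp
  have "0 \<le> (\<Sum>b\<in>Basis. (D y b + \<epsilon> *\<^sub>R ((- (1 / (y \<bullet> y)) *\<^sub>R b + (2 * (y \<bullet> b) / (y \<bullet> y)\<^sup>2) *\<^sub>R y)
       + ((2 * 0 * (0 \<bullet> b)) *\<^sub>R 0 + (2 * - 1) *\<^sub>R b))) \<bullet> b)"
    by (intro sum_nonneg hess)
  also have "\<dots> = (\<Sum>b\<in>Basis. D y b \<bullet> b + ((- \<epsilon> / (y \<bullet> y) - 2 * \<epsilon>) + (2 * \<epsilon> / (y \<bullet> y)\<^sup>2) * (((y \<bullet> b) *\<^sub>R y) \<bullet> b)))"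
    by (intro sum.cong refl) (simp add: inner_add_left algebra_simps diff_divide_distrib)
  also have "\<dots> = (\<Sum>b\<in>Basis. D y b \<bullet> b) + (real DIM('a) * (- \<epsilon> / (y \<bullet> y) - 2 * \<epsilon>) + (2 * \<epsilon> / (y \<bullet> y)\<^sup>2) * (y \<bullet> y))"
    by (simp only: sum.distrib sum_constant flip: sum_distrib_left) (simp only: trace_rank_one)
  also have "\<dots> \<le> real DIM('a) * (- \<epsilon> / (y \<bullet> y) - 2 * \<epsilon>) + 2 * \<epsilon> / (y \<bullet> y)"
    using superharmonic[of y] y r yy by (simp add: power2_eq_square)
  also have "\<dots> = (2 - real DIM('a)) * (\<epsilon> / (y \<bullet> y)) - real DIM('a) * (2 * \<epsilon>)"
    by (simp add: algebra_simps)
  also have "\<dots> < 0"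
  proof -
    have "(2 - real DIM('a)) * (\<epsilon> / (y \<bullet> y)) \<le> 0"
      using dim \<epsilon>(1) yy by (intro mult_nonpos_nonneg) auto
    moreover have "real DIM('a) * (2 * \<epsilon>) > 0"
      using \<epsilon>(1) by simp
    ultimately show ?thesis by linarith
  qed
  finally show False by simp
qed

text \<open>
  A superharmonic function cannot touch a convex wedge at its ridge.  With \<open>q = p\<^sub>2 - p\<^sub>1\<close> and after
  subtracting an affine function, \<open>u\<close> lies above \<open>\<bar>q \<bullet> x\<bar> / 2 - \<eta> r\<close> on the ball of radius \<open>r\<close>,
  where \<open>\<eta>\<close> may be chosen as small as desired.  On this ball
  \<open>\<bar>q \<bullet> x\<bar> \<ge> (q \<bullet> x)\<^sup>2 / (norm q * r)\<close>, and subtracting a multiple of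
  \<open>(norm x)\<^sup>2\<close> makes the right-hand side harmonic.  That harmonic quadratic loses only
  \<open>norm q * r / (2 n)\<close> on the sphere, which can be added back; hence the comparison function has
  the value \<open>norm q * r / (2 n) - \<eta> r > 0\<close> at the origin.
\<close>

lemma superharmonic_above_two_gradients:
  fixes u :: "'a::euclidean_space \<Rightarrow> real"
  assumes dim: "DIM('a) \<ge> 2"
    and so: "second_order_on u g D (ball 0 R - {0})" and R: "R > 0"
    and superharmonic: "\<And>x. x \<in> ball 0 R - {0} \<Longrightarrow> (\<Sum>b\<in>Basis. D x b \<bullet> b) \<le> 0"
    and above: "\<And>x. x \<in> ball 0 R - {0} \<Longrightarrow> w\<^sub>1 x \<le> u x" "\<And>x. x \<in> ball 0 R - {0} \<Longrightarrow> w\<^sub>2 x \<le> u x"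
    and w1: "(w\<^sub>1 has_derivative (\<lambda>h. p\<^sub>1 \<bullet> h)) (at 0)" "w\<^sub>1 0 = c"
    and w2: "(w\<^sub>2 has_derivative (\<lambda>h. p\<^sub>2 \<bullet> h)) (at 0)" "w\<^sub>2 0 = c"
    and ne: "p\<^sub>1 \<noteq> p\<^sub>2"
  obtains \<kappa> where "\<kappa> > 0" "\<forall>\<^sub>F x in at 0. c + \<kappa> < u x"
proof -
  define q where "q = p\<^sub>2 - p\<^sub>1"
  define V where "V = (1/2) *\<^sub>R (p\<^sub>1 + p\<^sub>2)"
  define n where "n = real DIM('a)"
  \<comment> \<open>Half of the gain at the origin is given up to absorb the first-order errors of the two functions.\<close>
  define \<eta> where "\<eta> = norm q / (4 * n)"
  have q: "norm q > 0" using ne by (simp add: q_def)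
  have n: "n > 0" by (simp add: n_def)
  have \<eta>: "\<eta> > 0" using q n by (simp add: \<eta>_def)
  obtain d1 where d1: "d1 > 0" "\<And>x. norm x < d1 \<Longrightarrow> \<bar>w\<^sub>1 x - c - p\<^sub>1 \<bullet> x\<bar> \<le> \<eta> * norm x"
    using w1(1)[unfolded has_derivative_at_alt] \<eta> unfolding w1(2) diff_zero real_norm_def by blast
  obtain d2 where d2: "d2 > 0" "\<And>x. norm x < d2 \<Longrightarrow> \<bar>w\<^sub>2 x - c - p\<^sub>2 \<bullet> x\<bar> \<le> \<eta> * norm x"
    using w2(1)[unfolded has_derivative_at_alt] \<eta> unfolding w2(2) diff_zero real_norm_def by blast
  define r where "r = min (min d1 d2) R / 2"
  have r: "0 < r" "r < d1" "r < d2" "r < R"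
    using d1 d2 R by (auto simp: r_def)
  have p12: "p\<^sub>1 \<bullet> x = V \<bullet> x - (q \<bullet> x) / 2" "p\<^sub>2 \<bullet> x = V \<bullet> x + (q \<bullet> x) / 2" for x
    by (auto simp: V_def q_def algebra_simps diff_divide_distrib)
  have wedge: "\<bar>q \<bullet> x\<bar> / 2 - \<eta> * r \<le> u x - c - V \<bullet> x" if "x \<noteq> 0" "norm x \<le> r" for x
  proof -
    have "w\<^sub>1 x \<le> u x" "w\<^sub>2 x \<le> u x"
      using above that r by auto
    moreover have "\<bar>w\<^sub>1 x - c - p\<^sub>1 \<bullet> x\<bar> \<le> \<eta> * norm x" "\<bar>w\<^sub>2 x - c - p\<^sub>2 \<bullet> x\<bar> \<le> \<eta> * norm x"
      using d1(2)[of x] d2(2)[of x] that r by auto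
    moreover have "\<eta> * norm x \<le> \<eta> * r"
      using \<eta> that by simp
    ultimately show ?thesis
      unfolding p12 by (auto simp: abs_if split: if_splits)
  qed
  define A B \<kappa> where "A = 1 / (2 * norm q * r)" and "B = norm q / (2 * n * r)" and "\<kappa> = norm q * r / (4 * n)"
  have pos: "A > 0" "B > 0" "\<kappa> > 0"
    using q n r by (auto simp: A_def B_def \<kappa>_def)
  define h where "h = (\<lambda>x. (c + \<kappa>) + V \<bullet> x + A * (q \<bullet> x)\<^sup>2 + (- B) * (x \<bullet> x))"
  define W where "W = (\<lambda>x. u x - h x)"
  have soW: "second_order_on W (\<lambda>x. g x - (V + (2 * A * (q \<bullet> x)) *\<^sub>R q + (2 * - B) *\<^sub>R x))
    (\<lambda>x h. D x h - ((2 * A * (q \<bullet> h)) *\<^sub>R q + (2 * - B) *\<^sub>R h)) (ball 0 R - {0})"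
    unfolding W_def h_def by (intro second_order_on_diff so quadratic_second_order)
  have harmonic: "(\<Sum>b\<in>Basis. ((2 * A * (q \<bullet> b)) *\<^sub>R q + (2 * - B) *\<^sub>R b) \<bullet> b) = 0"
  proof -
    have "(\<Sum>b\<in>Basis. ((2 * A * (q \<bullet> b)) *\<^sub>R q + (2 * - B) *\<^sub>R b) \<bullet> b)
      = (\<Sum>b\<in>Basis. (2 * A) * (((q \<bullet> b) *\<^sub>R q) \<bullet> b) + - (2 * B))"
      by (intro sum.cong refl) (simp add: inner_diff_left)
    also have "\<dots> = 2 * A * (q \<bullet> q) + n * - (2 * B)"
      by (simp only: sum.distrib sum_constant n_def flip: sum_distrib_left) (simp only: trace_rank_one)
    also have "\<dots> = 0"
      using q n r by (simp add: A_def B_def power2_eq_square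
          flip: power2_norm_eq_inner)
    finally show ?thesis .
  qed
  have trW: "(\<Sum>b\<in>Basis. (D x b - ((2 * A * (q \<bullet> b)) *\<^sub>R q + (2 * - B) *\<^sub>R b)) \<bullet> b) \<le> 0"
    if "x \<in> ball 0 R - {0}" for x
    using superharmonic[OF that] by (simp only: inner_diff_left[of "D x _"] sum_subtractf harmonic)
  have qx: "\<bar>q \<bullet> x\<bar> \<le> norm q * r" if "norm x \<le> r" for x
    using Cauchy_Schwarz_ineq2[of q x] mult_left_mono[OF that, of "norm q"] by simp
  have Aq: "A * (q \<bullet> x)\<^sup>2 \<le> \<bar>q \<bullet> x\<bar> / 2" if "norm x \<le> r" for x
  proof -
    have "(q \<bullet> x)\<^sup>2 \<le> \<bar>q \<bullet> x\<bar> * (norm q * r)"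
      using mult_left_mono[OF qx[OF that], of "\<bar>q \<bullet> x\<bar>"] by (simp add: power2_eq_square)
    then show ?thesis
      using q r by (simp add: A_def field_simps)
  qed
  have coeffs: "\<kappa> = \<eta> * r" "B * r\<^sup>2 = 2 * (\<eta> * r)"
    using r n by (simp_all add: \<kappa>_def \<eta>_def B_def power2_eq_square)
  have W_ge: "B * (x \<bullet> x) - 2 * (\<eta> * r) \<le> W x" if "x \<noteq> 0" "norm x \<le> r" for x
    using wedge[OF that] Aq[OF that(2)] by (simp add: W_def h_def coeffs(1))
  have W_nonneg: "0 \<le> W x" if "x \<noteq> 0" "norm x \<le> r" for x
  proof (rule superharmonic_punctured_ball_nonneg[OF dim soW trW \<open>r < R\<close> _ _ that])
    show "0 \<le> W y" if "norm y = r" for y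
    proof -
      have "y \<bullet> y = r\<^sup>2" using that power2_norm_eq_inner by metis
      moreover have "y \<noteq> 0" using that r by auto
      ultimately show ?thesis using W_ge[of y] that coeffs(2) by simp
    qed
    show "- 2 * (\<eta> * r) \<le> W y" if "y \<noteq> 0" "norm y \<le> r" for y
    proof -
      have "0 \<le> B * (y \<bullet> y)" using pos by simp
      then show ?thesis using W_ge[OF that] by linarith
    qed
  qed
  have "(h \<longlongrightarrow> h 0) (at 0)"
    unfolding h_def by (intro tendsto_intros)
  then have "\<forall>\<^sub>F x in at 0. c + \<kappa> / 2 < h x"
    by (rule order_tendstoD) (use pos in \<open>simp add: h_def\<close>)
  moreover have "\<forall>\<^sub>F x in at 0. x \<noteq> 0 \<and> norm x \<le> r"
    using r by (auto simp: eventually_at intro!: exI[of _ r])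
  ultimately have "\<forall>\<^sub>F x in at 0. c + \<kappa> / 2 < u x"
    proof eventually_elim
    case (elim x)
    then show ?case
      using W_nonneg[of x] by (simp add: W_def)
  qed
  then show ?thesis
    using that[of "\<kappa> / 2"] pos by simp
qed

section \<open>The elliptic operator\<close>

text \<open>
  The trace of the product of two positive semidefinite matrices is nonnegative.  Gaussian
  elimination replaces a spectral decomposition: peeling off the rank-one matrix built from
  row \<open>k\<close> leaves a positive semidefinite matrix with fewer nonzero diagonal entries, and a zero
  diagonal entry of such a matrix forces a zero row.
\<close>

lemma positive_semidefinite_pairing_nonneg:
  fixes A N :: "real^'n^'n"
  assumes A: "\<And>x. 0 \<le> x \<bullet> (A *v x)"
    and "transpose N = N" and "\<And>x. 0 \<le> x \<bullet> (N *v x)"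
  shows "0 \<le> (\<Sum>i\<in>UNIV. \<Sum>j\<in>UNIV. A $ i $ j * N $ i $ j)"
  using assms(2,3)
proof (induction "card {i. N $ i $ i \<noteq> 0}" arbitrary: N rule: less_induct)
  case less
  have sym: "N $ i $ j = N $ j $ i" for i j
    using less.prems(1) by (simp add: vec_eq_iff transpose_def)
  have quad: "x \<bullet> (N *v x) = (\<Sum>i\<in>UNIV. \<Sum>j\<in>UNIV. N $ i $ j * x $ i * x $ j)" for x
    by (simp add: inner_vec_def matrix_vector_mult_def sum_distrib_left mult_ac)
  have ex: "(s *\<^sub>R axis i 1 + t *\<^sub>R axis j 1) \<bullet> (N *v (s *\<^sub>R axis i 1 + t *\<^sub>R axis j 1))
      = s\<^sup>2 * N $ i $ i + 2 * s * t * N $ i $ j + t\<^sup>2 * N $ j $ j" for s t i j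
    by (simp add: matrix_vector_right_distrib matrix_vector_mult_scaleR inner_add_left inner_add_right
        matrix_vector_mult_basis inner_axis' column_def sym[of j i] power2_eq_square algebra_simps)
  have diag: "0 \<le> N $ i $ i" for i
    using less.prems(2)[of "1 *\<^sub>R axis i 1 + 0 *\<^sub>R axis i 1"] unfolding ex by simp
  have row0: "N $ i $ j = 0" if "N $ i $ i = 0" for i j
  proof (rule ccontr)
    assume ne: "N $ i $ j \<noteq> 0"
    have "0 \<le> s\<^sup>2 * N $ i $ i + 2 * s * 1 * N $ i $ j + 1\<^sup>2 * N $ j $ j" for s
      using less.prems(2) unfolding ex[symmetric] .
    \<comment> \<open>At this value of s the form equals -1.\<close>
    from this[of "- (N $ j $ j + 1) / (2 * N $ i $ j)"] show False
      using that ne by (simp add: field_simps)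
  qed
  show ?case
  proof (cases "\<forall>i. N $ i $ i = 0")
    case True
    then show ?thesis using row0 by simp
  next
    case False
    then obtain k where k: "N $ k $ k \<noteq> 0" by blast
    then have kpos: "N $ k $ k > 0" using diag[of k] by simp
    define N' where "N' = (\<chi> i j. N $ i $ j - N $ k $ i * N $ k $ j / N $ k $ k)"
    have "N' $ i $ i = 0" if "N $ i $ i = 0" for i
      using that row0[OF that, of k] sym[of k i] by (simp add: N'_def)
    moreover have "N' $ k $ k = 0"
      using k by (simp add: N'_def)
    ultimately have sub: "{i. N' $ i $ i \<noteq> 0} \<subset> {i. N $ i $ i \<noteq> 0}"
      using k by blast
    have "transpose N' = N'"
      using sym by (simp add: N'_def transpose_def vec_eq_iff mult.commute)
    moreover have "0 \<le> x \<bullet> (N' *v x)" for x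
    proof -
      define c where "c = (\<Sum>j\<in>UNIV. N $ k $ j * x $ j)"
      have Nx: "(N *v x) $ k = c" by (simp add: c_def matrix_vector_mult_def)
      \<comment> \<open>This y minimizes the form of N over the line through x in direction k; the minimum is the Schur complement.\<close>
      define y where "y = x - (c / N $ k $ k) *\<^sub>R axis k 1"
      have cN: "x \<bullet> column k N = c"
        by (simp add: c_def inner_vec_def column_def sym[of k] mult.commute)
      have "0 \<le> y \<bullet> (N *v y)"
        by (rule less.prems(2))
      also have "\<dots> = x \<bullet> (N *v x) - c\<^sup>2 / N $ k $ k"
        using k by (simp add: y_def matrix_vector_mult_diff_distrib matrix_vector_mult_scaleR inner_diff_left
            inner_diff_right matrix_vector_mult_basis inner_axis' Nx cN column_def[of k N, THEN arg_cong, of "\<lambda>v. v $ k"]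
            power2_eq_square field_simps)
      also have "\<dots> = x \<bullet> (N' *v x)"
      proof -
        have "x \<bullet> (N' *v x) = (\<Sum>i\<in>UNIV. \<Sum>j\<in>UNIV. N $ i $ j * x $ i * x $ j
            - (N $ k $ i * x $ i) * (N $ k $ j * x $ j) / N $ k $ k)"
          by (simp add: N'_def inner_vec_def matrix_vector_mult_def sum_distrib_left algebra_simps)
        also have "\<dots> = x \<bullet> (N *v x) - c * c / N $ k $ k"
          by (simp add: sum_subtractf quad c_def sum_product flip: sum_divide_distrib)
        finally show ?thesis by (simp add: power2_eq_square)
      qed
      finally show ?thesis .
    qed
    ultimately have IH: "0 \<le> (\<Sum>i\<in>UNIV. \<Sum>j\<in>UNIV. A $ i $ j * N' $ i $ j)"
      using less.hyps[of N'] psubset_card_mono[OF _ sub] by simp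
    have "(\<Sum>i\<in>UNIV. \<Sum>j\<in>UNIV. A $ i $ j * N $ i $ j)
        = (\<Sum>i\<in>UNIV. \<Sum>j\<in>UNIV. A $ i $ j * N' $ i $ j + A $ i $ j * N $ k $ i * N $ k $ j / N $ k $ k)"
      by (intro sum.cong refl) (simp add: N'_def algebra_simps)
    also have "\<dots> = (\<Sum>i\<in>UNIV. \<Sum>j\<in>UNIV. A $ i $ j * N' $ i $ j) + (N $ k) \<bullet> (A *v (N $ k)) / N $ k $ k"
      by (simp add: sum.distrib inner_vec_def matrix_vector_mult_def sum_distrib_left mult_ac flip: sum_divide_distrib)
    finally show ?thesis
      using IH A[of "N $ k"] kpos by simp
  qed
qed

lemma sym_unit_in_sym_matrices: "sym_unit i j \<in> sym_matrices"
  by (simp add: sym_unit_def sym_matrices_def transpose_def vec_eq_iff add.commute conj_commute)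

lemma subspace_sym_matrices: "subspace sym_matrices"
  by (auto simp: subspace_def sym_matrices_def transpose_def vec_eq_iff)

lemma symmetric_matrix_expansion:
  fixes N :: "real^'n^'n"
  assumes "N \<in> sym_matrices"
  shows "(\<Sum>i\<in>UNIV. \<Sum>j\<in>UNIV. N $ i $ j *\<^sub>R sym_unit i j) = N"
proof -
  have sym: "N $ i $ j = N $ j $ i" for i j
    using assms by (simp add: sym_matrices_def vec_eq_iff transpose_def)
  have "(\<Sum>i\<in>UNIV. \<Sum>j\<in>UNIV. N $ i $ j *\<^sub>R sym_unit i j) $ k $ l = N $ k $ l" for k l
  proof -
    have entry: "(N $ i $ j *\<^sub>R sym_unit i j) $ k $ l
      = (if k = i then if l = j then N $ i $ j / 2 else 0 else 0)
          + (if l = i then if k = j then N $ i $ j / 2 else 0 else 0)" for i j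
      by (auto simp: sym_unit_def)
    have "(\<Sum>i\<in>UNIV. \<Sum>j\<in>UNIV. N $ i $ j *\<^sub>R sym_unit i j) $ k $ l
      = (\<Sum>i\<in>UNIV. (if k = i then \<Sum>j\<in>UNIV. if l = j then N $ i $ j / 2 else 0 else 0)
          + (if l = i then \<Sum>j\<in>UNIV. if k = j then N $ i $ j / 2 else 0 else 0))"
      unfolding sum_component entry sum.distrib
      by (intro arg_cong2[of _ _ _ _ "(+)"] sum.cong refl) auto
    also have "\<dots> = N $ k $ l / 2 + N $ l $ k / 2"
      by (simp add: sum.distrib)
    finally show ?thesis by (simp add: sym)
  qed
  then show ?thesis by (simp add: vec_eq_iff)
qed

lemma derivative_in_matrix_direction:
  fixes S :: "(real^'n) \<times> (real^'n^'n) \<Rightarrow> real"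
  assumes der: "(S has_derivative S') (at (p, M) within UNIV \<times> sym_matrices)"
    and M: "M \<in> sym_matrices" and N: "N \<in> sym_matrices"
  shows "S' (0, N) = (\<Sum>i\<in>UNIV. \<Sum>j\<in>UNIV. matrix_gradient S p M $ i $ j * N $ i $ j)"
proof -
  have lin: "linear S'"
    using has_derivative_linear[OF der] .
  have dir: "S' (0, sym_unit i j) = matrix_gradient S p M $ i $ j" for i j
  proof -
    have "((\<lambda>t. (p, M + t *\<^sub>R sym_unit i j)) has_derivative (\<lambda>t. (0, t *\<^sub>R sym_unit i j))) (at 0)"
      by (auto intro!: derivative_eq_intros)
    moreover have "(S has_derivative S') (at (p, M + 0 *\<^sub>R sym_unit i j) within range (\<lambda>t. (p, M + t *\<^sub>R sym_unit i j)))"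
      using der
      by (auto intro!: has_derivative_subset[OF der] subspace_add[OF subspace_sym_matrices] M
          subspace_scale[OF subspace_sym_matrices] sym_unit_in_sym_matrices)
    ultimately have "((\<lambda>t. S (p, M + t *\<^sub>R sym_unit i j)) has_derivative (\<lambda>t. S' (0, t *\<^sub>R sym_unit i j))) (at 0)"
      by (rule has_derivative_in_compose)
    moreover have "S' (0, t *\<^sub>R sym_unit i j) = S' (0, sym_unit i j) * t" for t
      using linear_cmul[OF lin, of t "(0, sym_unit i j)"] by simp
    ultimately show ?thesis
      by (auto simp: matrix_gradient_def has_field_derivative_def[symmetric] intro: DERIV_imp_deriv[symmetric])
  qed
  have "(0, N) = (\<Sum>i\<in>UNIV. \<Sum>j\<in>UNIV. N $ i $ j *\<^sub>R (0 :: real^'n, sym_unit i j))"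
    using symmetric_matrix_expansion[OF N] by (simp add: prod_eq_iff fst_sum snd_sum)
  then have "S' (0, N) = S' (\<Sum>i\<in>UNIV. \<Sum>j\<in>UNIV. N $ i $ j *\<^sub>R (0, sym_unit i j))"
    by (rule arg_cong)
  also have "\<dots> = (\<Sum>i\<in>UNIV. \<Sum>j\<in>UNIV. N $ i $ j *\<^sub>R S' (0, sym_unit i j))"
    by (simp only: linear_sum[OF lin] linear_cmul[OF lin])
  finally show ?thesis
    unfolding dir real_scaleR_def by (simp only: mult.commute)
qed

lemma elliptic_antimono:
  fixes S :: "(real^'n) \<times> (real^'n^'n) \<Rightarrow> real"
  assumes C1: "C1_on S (UNIV \<times> sym_matrices)"
    and elliptic: "\<And>p M. M \<in> sym_matrices \<Longrightarrow> positive_definite (- matrix_gradient S p M)"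
    and M: "M \<in> sym_matrices" and N: "N \<in> sym_matrices" and psd: "\<And>x. 0 \<le> x \<bullet> (N *v x)"
  shows "S (p, M + N) \<le> S (p, M)"
proof -
  obtain S' where S': "\<And>y. y \<in> UNIV \<times> sym_matrices \<Longrightarrow>
      (S has_derivative blinfun_apply (S' y)) (at y within UNIV \<times> sym_matrices)"
    using C1 unfolding C1_on_def by blast
  have in_sym: "M + t *\<^sub>R N \<in> sym_matrices" for t
    by (intro subspace_add[OF subspace_sym_matrices] M subspace_scale[OF subspace_sym_matrices] N)
  let ?\<gamma> = "\<lambda>t. (p, M + t *\<^sub>R N)"
  have der: "((\<lambda>t. S (?\<gamma> t)) has_derivative (\<lambda>s. S' (?\<gamma> t) (0, s *\<^sub>R N))) (at t within {0..1})" for t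
  proof -
    have path: "(?\<gamma> has_derivative (\<lambda>s. (0, s *\<^sub>R N))) (at t within {0..1})"
      by (auto intro!: derivative_eq_intros)
    have "(S has_derivative S' (?\<gamma> t)) (at (?\<gamma> t) within ?\<gamma> ` {0..1})"
      using in_sym by (intro has_derivative_subset[OF S']) auto
    from has_derivative_in_compose[OF path this] show ?thesis .
  qed
  obtain t where t: "S (?\<gamma> 1) - S (?\<gamma> 0) = S' (?\<gamma> t) (0, N)"
    using mvt_simple[of 0 1 "\<lambda>t. S (?\<gamma> t)", OF _ der] by auto
  have "S' (?\<gamma> t) (0, N) = - (\<Sum>i\<in>UNIV. \<Sum>j\<in>UNIV. (- matrix_gradient S p (M + t *\<^sub>R N)) $ i $ j * N $ i $ j)"
    using derivative_in_matrix_direction[OF S'[of "?\<gamma> t"] in_sym N] in_sym by (simp add: sum_negf)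
  also have "\<dots> \<le> 0"
  proof -
    have "0 \<le> x \<bullet> ((- matrix_gradient S p (M + t *\<^sub>R N)) *v x)" for x
      using elliptic[OF in_sym, of p t] unfolding positive_definite_def by (cases "x = 0") (auto simp: less_imp_le)
    from positive_semidefinite_pairing_nonneg[OF this _ psd] N show ?thesis
      by (auto simp: sym_matrices_def)
  qed
  finally show ?thesis using t by simp
qed

lemma T_op_antimono:
  fixes S :: "(real^'n) \<times> (real^'n^'n) \<Rightarrow> real"
  assumes C1: "C1_on S (UNIV \<times> sym_matrices)"
    and elliptic: "\<And>p M. M \<in> sym_matrices \<Longrightarrow> positive_definite (- matrix_gradient S p M)"
    and M: "M \<in> sym_matrices" and N: "N \<in> sym_matrices" and psd: "\<And>x. 0 \<le> x \<bullet> (N *v x)"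
  shows "T_op S \<beta> t p (M + N) \<le> T_op S \<beta> t p M"
proof -
  have "0 \<le> x \<bullet> ((c *\<^sub>R N) *v x)" if "c \<ge> 0" for c x
    using psd[of x] that by (simp add: scaleR_matrix_vector_assoc[symmetric])
  then show ?thesis
    unfolding T_op_def scaleR_add_right
    by (intro elliptic_antimono[OF C1 elliptic]) (auto intro: M N subspace_scale[OF subspace_sym_matrices])
qed

text \<open>
  The map through which \<open>T\<close> factors; \<open>\<beta>\<close> enters only through the two exponents.
\<close>

definition scaled :: "real \<Rightarrow> real \<Rightarrow> real \<times> (real^'n) \<times> (real^'n^'n) \<Rightarrow> (real^'n) \<times> (real^'n^'n)" where
  "scaled a b = (\<lambda>(t, p, M). (t powr a *\<^sub>R p, t powr b *\<^sub>R M))"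

definition scaled_derivative :: "real \<Rightarrow> real \<Rightarrow> real \<times> (real^'n) \<times> (real^'n^'n) \<Rightarrow>
    real \<times> (real^'n) \<times> (real^'n^'n) \<Rightarrow> (real^'n) \<times> (real^'n^'n)" where
  "scaled_derivative a b = (\<lambda>(t, p, M) (s, q, Q).
     (t powr a *\<^sub>R q + (a * t powr (a - 1) * s) *\<^sub>R p, t powr b *\<^sub>R Q + (b * t powr (b - 1) * s) *\<^sub>R M))"

lemma scaled_has_derivative:
  assumes "fst z > 0" "z \<in> X"
  shows "(scaled a b has_derivative scaled_derivative a b z) (at z within X)"
proof -
  obtain t p M where z: "z = (t, p, M)" by (cases z)
  have eq: "scaled a b = (\<lambda>z. (fst z powr a *\<^sub>R fst (snd z), fst z powr b *\<^sub>R snd (snd z)))"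
    by (auto simp: scaled_def fun_eq_iff)
  show ?thesis
    unfolding eq using assms
    by (auto simp: z scaled_derivative_def fun_eq_iff powr_diff intro!: derivative_eq_intros)
qed

lemma scaled_derivative_scaleR:
  "scaled_derivative a b z (c *\<^sub>R d) = c *\<^sub>R scaled_derivative a b z d"
  by (auto simp: scaled_derivative_def split_beta scaleR_add_right mult_ac)

text \<open>
  If the derivative of \<open>T\<close> at the jet \<open>z0\<close> in direction \<open>d0\<close> is negative, continuity of the
  derivative keeps it negative for jets near \<open>z0\<close> and directions near \<open>d0\<close>, and the mean value
  theorem makes \<open>T\<close> decrease along short steps.  The uniformity in \<open>z\<close> and \<open>d\<close> is essential,
  since the point of contact is not known in advance.
\<close>

lemma strict_decrease_near:
  fixes S :: "(real^'n) \<times> (real^'n^'n) \<Rightarrow> real"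
  defines "X \<equiv> {0<..} \<times> UNIV \<times> sym_matrices"
  assumes der: "\<And>y. y \<in> UNIV \<times> sym_matrices \<Longrightarrow>
      (S has_derivative blinfun_apply (S' y)) (at y within UNIV \<times> sym_matrices)"
    and cont: "continuous_on (UNIV \<times> sym_matrices) S'"
    and z0: "z0 \<in> X" and d0: "d0 \<in> UNIV \<times> UNIV \<times> sym_matrices"
    and neg: "S' (scaled a b z0) (scaled_derivative a b z0 d0) < 0"
  obtains \<eta> where "\<eta> > 0"
    and "\<And>z d \<epsilon>. z \<in> X \<Longrightarrow> d \<in> UNIV \<times> UNIV \<times> sym_matrices \<Longrightarrow> dist z z0 < \<eta> \<Longrightarrow> dist d d0 < \<eta> \<Longrightarrow>
        0 < \<epsilon> \<Longrightarrow> \<epsilon> < \<eta> \<Longrightarrow> z + \<epsilon> *\<^sub>R d \<in> X \<and> S (scaled a b (z + \<epsilon> *\<^sub>R d)) < S (scaled a b z)"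
proof -
  define Y :: "(real \<times> (real^'n) \<times> (real^'n^'n)) set" where "Y = UNIV \<times> UNIV \<times> sym_matrices"
  define F where "F = (\<lambda>(z, d). blinfun_apply (S' (scaled a b z)) (scaled_derivative a b z d))"
  have scaled_in: "scaled a b z \<in> UNIV \<times> sym_matrices" if "z \<in> X" for z
    using that by (auto simp: scaled_def X_def intro: subspace_scale[OF subspace_sym_matrices])
  have contF: "continuous_on (X \<times> Y) F"
  proof -
    have "continuous_on (X \<times> Y) (\<lambda>zd. scaled a b (fst zd))"
      unfolding scaled_def split_beta by (intro continuous_intros) (auto simp: X_def)
    moreover have "(\<lambda>zd. scaled a b (fst zd)) ` (X \<times> Y) \<subseteq> UNIV \<times> sym_matrices"
      by (intro image_subsetI scaled_in) auto
    ultimately have "continuous_on (X \<times> Y) (\<lambda>zd. S' (scaled a b (fst zd)))"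
      by (rule continuous_on_compose2[OF cont])
    moreover have "continuous_on (X \<times> Y) (\<lambda>zd. scaled_derivative a b (fst zd) (snd zd))"
      unfolding scaled_derivative_def split_beta by (intro continuous_intros) (auto simp: X_def)
    ultimately show ?thesis
      unfolding F_def split_beta by (intro continuous_intros)
  qed
  have "(z0, d0) \<in> X \<times> Y"
    using z0 d0 by (simp add: Y_def)
  moreover have "- F (z0, d0) > 0"
    using neg by (simp add: F_def)
  ultimately obtain \<delta> where \<delta>: "\<delta> > 0"
    and negF: "\<And>zd. zd \<in> X \<times> Y \<Longrightarrow> dist zd (z0, d0) < \<delta> \<Longrightarrow> dist (F zd) (F (z0, d0)) < - F (z0, d0)"
    using contF unfolding continuous_on_iff by meson
  have F_neg: "F (z, d) < 0" if "z \<in> X" "d \<in> Y" "dist z z0 < \<delta> / 2" "dist d d0 < \<delta> / 2" for z d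
  proof -
    have "dist (z, d) (z0, d0) \<le> dist z z0 + dist d d0"
      using sqrt_sum_squares_le_sum[of "dist z z0" "dist d d0"] by (simp add: dist_Pair_Pair)
    then show ?thesis
      using negF[of "(z, d)"] that by (auto simp: dist_real_def)
  qed
  \<comment> \<open>Staying within fst z0 of z0 keeps the first component positive along the whole step.\<close>
  define m where "m = min (\<delta> / 2) (fst z0)"
  have m: "m > 0"
    using \<delta> z0 by (auto simp: m_def X_def)
  define \<eta> where "\<eta> = min (m / 2) (m / 2 / (norm d0 + m))"
  have nm: "norm d0 + m > 0"
    using m by (simp add: add_nonneg_pos)
  show ?thesis
  proof (rule that)
    show "\<eta> > 0"
      using m nm by (simp add: \<eta>_def)
    fix z d \<epsilon>
    assume z: "z \<in> X" and d: "d \<in> UNIV \<times> UNIV \<times> sym_matrices" and dz: "dist z z0 < \<eta>" and dd: "dist d d0 < \<eta>"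
      and \<epsilon>: "0 < \<epsilon>" "\<epsilon> < \<eta>"
    have dY: "d \<in> Y" using d by (simp add: Y_def)
    have nd: "norm d < norm d0 + m"
      using dd m norm_triangle_sub[of d d0] by (auto simp: \<eta>_def dist_norm)
    have near: "dist (z + t *\<^sub>R d) z0 < m" if "0 \<le> t" "t \<le> \<epsilon>" for t
    proof -
      have "t * norm d \<le> \<eta> * (norm d0 + m)"
        using that \<epsilon> nd by (intro mult_mono) auto
      also have "\<dots> \<le> m / 2 / (norm d0 + m) * (norm d0 + m)"
        using nm by (intro mult_right_mono) (auto simp: \<eta>_def)
      also have "\<dots> = m / 2"
        using nm by (intro nonzero_eq_divide_eq[THEN iffD1, OF _ refl]) simp
      finally have "norm (t *\<^sub>R d) \<le> m / 2"
        using that by simp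
      moreover have "dist z z0 < m / 2"
        using dz by (simp add: \<eta>_def)
      moreover have "dist (z + t *\<^sub>R d) z0 \<le> norm (t *\<^sub>R d) + dist z z0"
        using dist_triangle[of "z + t *\<^sub>R d" z0 z] by (simp add: dist_norm)
      ultimately show ?thesis by linarith
    qed
    have inX: "z + t *\<^sub>R d \<in> X" if "0 \<le> t" "t \<le> \<epsilon>" for t
    proof -
      have "\<bar>fst (z + t *\<^sub>R d) - fst z0\<bar> < fst z0"
        using near[OF that] dist_fst_le[of "z + t *\<^sub>R d" z0] by (simp add: m_def dist_real_def)
      then have "fst (z + t *\<^sub>R d) > 0" by linarith
      then show ?thesis
        using z d by (auto simp: X_def mem_Times_iff
            intro!: subspace_add[OF subspace_sym_matrices] subspace_scale[OF subspace_sym_matrices])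
    qed
    let ?f = "\<lambda>t. S (scaled a b (z + t *\<^sub>R d))"
    have derf: "(?f has_derivative (\<lambda>s. s * F (z + t *\<^sub>R d, d))) (at t within {0..\<epsilon>})"
      if t: "0 \<le> t" "t \<le> \<epsilon>" for t
    proof -
      have line: "((\<lambda>t. z + t *\<^sub>R d) has_derivative (\<lambda>s. s *\<^sub>R d)) (at t within {0..\<epsilon>})"
        by (auto intro!: derivative_eq_intros)
      have pos: "fst (z + t *\<^sub>R d) > 0"
        using inX[OF t] by (auto simp: X_def mem_Times_iff)
      have path: "((\<lambda>t. scaled a b (z + t *\<^sub>R d)) has_derivative
          (\<lambda>s. scaled_derivative a b (z + t *\<^sub>R d) (s *\<^sub>R d))) (at t within {0..\<epsilon>})"
        by (rule has_derivative_in_compose[OF line scaled_has_derivative[OF pos]]) (use t in auto)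
      have "(S has_derivative S' (scaled a b (z + t *\<^sub>R d))) (at (scaled a b (z + t *\<^sub>R d))
          within (\<lambda>t. scaled a b (z + t *\<^sub>R d)) ` {0..\<epsilon>})"
        by (intro has_derivative_subset[OF der] image_subsetI scaled_in inX) (use t in auto)
      from has_derivative_in_compose[OF path this] show ?thesis
        by (simp add: F_def scaled_derivative_scaleR blinfun.scaleR_right)
    qed
    obtain t where t: "t \<in> {0<..<\<epsilon>}" "?f \<epsilon> - ?f 0 = (\<epsilon> - 0) * F (z + t *\<^sub>R d, d)"
      using mvt_simple[of 0 \<epsilon> ?f, OF \<epsilon>(1) derf] by blast
    have "dist d d0 < \<delta> / 2" using dd m by (auto simp: \<eta>_def m_def)
    then have "F (z + t *\<^sub>R d, d) < 0"
      using t near[of t] inX[of t] dY by (intro F_neg) (auto simp: m_def)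
    then have "?f \<epsilon> < ?f 0"
      using t(2) \<epsilon>(1) by (smt (verit) mult_pos_neg)
    then show "z + \<epsilon> *\<^sub>R d \<in> X \<and> S (scaled a b (z + \<epsilon> *\<^sub>R d)) < S (scaled a b z)"
      using inX[of \<epsilon>] \<epsilon> by simp
  qed
qed

section \<open>Touching from below\<close>

lemma C2_on_second_order:
  fixes f :: "real^'n \<Rightarrow> real"
  assumes "C2_on f X" and "open X"
  shows "second_order_on f (gradient f) (\<lambda>x h. hessian f x *v h) X"
    and "continuous_on X (gradient f)" and "continuous_on X (hessian f)"
proof -
  obtain f' where f': "\<And>x. x \<in> X \<Longrightarrow> (f has_derivative blinfun_apply (f' x)) (at x)"
    using assms unfolding C2_on_def C1_on_def by (metis at_within_open)
  obtain g' where g': "\<And>x. x \<in> X \<Longrightarrow> (gradient f has_derivative blinfun_apply (g' x)) (at x)"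
    and cont: "continuous_on X g'"
    using assms unfolding C2_on_def C1_on_def by (metis at_within_open)
  have grad: "blinfun_apply (f' x) h = gradient f x \<bullet> h" if "x \<in> X" for x h
  proof -
    have "blinfun_apply (f' x) h = blinfun_apply (f' x) (\<Sum>i\<in>UNIV. (h $ i) *\<^sub>R axis i 1)"
      by (simp add: basis_expansion flip: scalar_mult_eq_scaleR)
    also have "\<dots> = (\<Sum>i\<in>UNIV. h $ i * blinfun_apply (f' x) (axis i 1))"
      by (simp add: blinfun.sum_right blinfun.scaleR_right)
    also have "\<dots> = gradient f x \<bullet> h"
      using frechet_derivative_at[OF f'[OF that]] by (simp add: gradient_def inner_vec_def mult.commute)
    finally show ?thesis .
  qed
  have hess: "(gradient f has_derivative (\<lambda>h. hessian f x *v h)) (at x)" if "x \<in> X" for x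
    using g'[OF that] jacobian_works[of "gradient f" "at x"] unfolding hessian_def differentiable_def by blast
  show "second_order_on f (gradient f) (\<lambda>x h. hessian f x *v h) X"
    unfolding second_order_on_def
  proof (intro ballI conjI hess)
    fix x assume x: "x \<in> X"
    have "blinfun_apply (f' x) = (\<lambda>h. gradient f x \<bullet> h)"
      using grad[OF x] by blast
    then show "(f has_derivative (\<lambda>h. gradient f x \<bullet> h)) (at x)"
      using f'[OF x] by simp
  qed
  show "continuous_on X (gradient f)"
    using g' has_derivative_continuous continuous_at_imp_continuous_on by blast
  have "hessian f x = (\<chi> i j. blinfun_apply (g' x) (axis j 1) $ i)" if "x \<in> X" for x
    using frechet_derivative_at[OF g'[OF that]] by (simp add: hessian_def jacobian_def matrix_def)
  moreover have "continuous_on X (\<lambda>x. \<chi> i j. blinfun_apply (g' x) (axis j 1) $ i)"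
    by (intro continuous_on_vec_lambda continuous_intros cont)
  ultimately show "continuous_on X (hessian f)"
    by (simp cong: continuous_on_cong)
qed

lemma hessian_in_sym_matrices:
  fixes f :: "real^'n \<Rightarrow> real"
  assumes "C2_on f X" "open X" "x \<in> X"
  shows "hessian f x \<in> sym_matrices"
proof -
  have "(hessian f x *v axis i 1) \<bullet> axis j 1 = (hessian f x *v axis j 1) \<bullet> axis i 1" for i j
    by (rule second_derivative_symmetric[OF C2_on_second_order(1)[OF assms(1,2)] assms(2,3)])
  then have "hessian f x $ j $ i = hessian f x $ i $ j" for i j
    by (simp add: matrix_vector_mult_basis inner_axis column_def)
  then show ?thesis
    by (simp add: sym_matrices_def transpose_def vec_eq_iff)
qed

lemma laplacian_eq_sum_Basis: "laplacian f x = (\<Sum>b\<in>Basis. (hessian f x *v b) \<bullet> b)"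
proof -
  have B: "Basis = range (\<lambda>i. axis i (1::real))"
    by (auto simp: Basis_vec_def)
  have "(\<Sum>b\<in>Basis. (hessian f x *v b) \<bullet> b) = (\<Sum>i\<in>UNIV. (hessian f x *v axis i 1) \<bullet> axis i 1)"
    unfolding B by (subst sum.reindex) (auto simp: inj_on_def axis_eq_axis)
  also have "\<dots> = laplacian f x"
    by (simp add: laplacian_def trace_def matrix_vector_mult_basis inner_axis column_def)
  finally show ?thesis ..
qed

text \<open>
  The matrix \<open>e e\<^sup>T\<close>, half the Hessian of \<open>(e \<bullet> x)\<^sup>2\<close>.
\<close>

definition outer :: "real^'n \<Rightarrow> real^'n^'n" where
  "outer e = (\<chi> i j. e $ i * e $ j)"

lemma outer_mult: "outer e *v h = (e \<bullet> h) *\<^sub>R e"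
  by (simp add: outer_def matrix_vector_mult_def inner_vec_def vec_eq_iff sum_distrib_left mult_ac)

lemma outer_in_sym_matrices: "outer e \<in> sym_matrices"
  by (simp add: outer_def sym_matrices_def transpose_def vec_eq_iff mult.commute)

lemma T_op_scaled: "T_op S \<beta> t p M = S (scaled (- ((1 + \<beta>) / \<beta>)) (- ((2 + \<beta>) / \<beta>)) (t, p, M))"
  by (simp add: T_op_def scaled_def)

text \<open>
  The direction is the jet at the origin of \<open>e \<bullet> x + K (e \<bullet> x)\<^sup>2\<close>.  The value of this function
  vanishes there, its gradient contributes a fixed amount, and by ellipticity its Hessian
  contributes a negative amount proportional to \<open>K\<close>, which prevails for large \<open>K\<close>.
\<close>

lemma decreasing_direction:
  fixes S :: "(real^'n) \<times> (real^'n^'n) \<Rightarrow> real"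
  assumes der: "\<And>y. y \<in> UNIV \<times> sym_matrices \<Longrightarrow>
      (S has_derivative blinfun_apply (S' y)) (at y within UNIV \<times> sym_matrices)"
    and elliptic: "\<And>p M. M \<in> sym_matrices \<Longrightarrow> positive_definite (- matrix_gradient S p M)"
    and t: "t > 0" and M: "M \<in> sym_matrices" and e: "e \<noteq> 0"
  obtains K where "S' (scaled a b (t, p, M)) (scaled_derivative a b (t, p, M) (0, e, (2 * K) *\<^sub>R outer e)) < 0"
proof -
  define P where "P = t powr a *\<^sub>R p"
  define N where "N = t powr b *\<^sub>R M"
  have N: "N \<in> sym_matrices"
    using M by (simp add: N_def subspace_scale[OF subspace_sym_matrices])
  define L where "L = blinfun_apply (S' (P, N))"
  define c where "c = e \<bullet> ((- matrix_gradient S P N) *v e)"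
  have c: "c > 0"
    using elliptic[OF N, of P] e by (simp add: positive_definite_def c_def)
  have outer: "L (0, outer e) = - c"
  proof -
    have "L (0, outer e) = (\<Sum>i\<in>UNIV. \<Sum>j\<in>UNIV. matrix_gradient S P N $ i $ j * outer e $ i $ j)"
      unfolding L_def using N by (intro derivative_in_matrix_direction der outer_in_sym_matrices) auto
    also have "\<dots> = - c"
      by (simp add: c_def outer_def inner_vec_def matrix_vector_mult_def sum_distrib_left sum_negf mult_ac)
    finally show ?thesis .
  qed
  define K where "K = (\<bar>L (t powr a *\<^sub>R e, 0)\<bar> + 1) / (2 * t powr b * c)"
  have "S' (scaled a b (t, p, M)) (scaled_derivative a b (t, p, M) (0, e, (2 * K) *\<^sub>R outer e))
    = L ((t powr a *\<^sub>R e, 0) + (t powr b * (2 * K)) *\<^sub>R (0, outer e))"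
    by (simp add: scaled_def scaled_derivative_def L_def P_def N_def)
  also have "\<dots> = L (t powr a *\<^sub>R e, 0) - 2 * t powr b * K * c"
    using outer by (simp only: L_def blinfun.add_right blinfun.scaleR_right) simp
  also have "\<dots> = L (t powr a *\<^sub>R e, 0) - (\<bar>L (t powr a *\<^sub>R e, 0)\<bar> + 1)"
    using c t by (simp add: K_def)
  also have "\<dots> < 0"
    by linarith
  finally show ?thesis
    by (rule that)
qed

text \<open>
  For large \<open>K\<close> the perturbation \<open>v + \<epsilon> \<phi>\<close> with \<open>\<phi> x = e \<bullet> x + K (e \<bullet> x)\<^sup>2\<close> is a strict
  subsolution near the origin, robustly enough to survive the addition of a constant small
  compared with \<open>\<epsilon>\<close>.  If \<open>u\<close> failed to lie above it, then \<open>u - v - \<epsilon> \<phi>\<close> would have a negative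
  minimum at some \<open>y \<noteq> 0\<close>: near the origin this function is at least \<open>- \<epsilon> \<phi>\<close>, which tends to
  zero, and on the sphere it is positive for small \<open>\<epsilon>\<close>.  Since \<open>u > v\<close>, the minimum is larger
  than \<open>- \<epsilon> \<phi> y\<close>, so the constant is indeed small compared with \<open>\<epsilon>\<close>.  At \<open>y\<close> the function \<open>u\<close>
  is touched from below by a strict subsolution, which ellipticity forbids.
\<close>

lemma supersolution_above_tilted_subsolution:
  fixes S :: "(real^'n) \<times> (real^'n^'n) \<Rightarrow> real" and e :: "real^'n"
  assumes C1: "C1_on S (UNIV \<times> sym_matrices)"
    and elliptic: "\<And>p M. M \<in> sym_matrices \<Longrightarrow> positive_definite (- matrix_gradient S p M)"
    and R: "R > 0"
    and u_C2: "C2_on u (ball 0 R - {0})"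
    and v_C2: "C2_on v (ball 0 R)"
    and v_pos: "\<And>x. x \<in> ball 0 R \<Longrightarrow> v x > 0"
    and u_gt_v: "\<And>x. x \<in> ball 0 R - {0} \<Longrightarrow> u x > v x"
    and Tu: "\<And>x. x \<in> ball 0 R - {0} \<Longrightarrow> T_op S \<beta> (u x) (gradient u x) (hessian u x) \<ge> 0"
    and Tv: "\<And>x. x \<in> ball 0 R - {0} \<Longrightarrow> T_op S \<beta> (v x) (gradient v x) (hessian v x) \<le> 0"
    and e: "e \<noteq> 0"
  obtains K \<epsilon> r where "0 < r" "r < R" "\<epsilon> > 0"
    and "\<And>x. x \<in> ball 0 r - {0} \<Longrightarrow> v x + \<epsilon> * (e \<bullet> x + K * (e \<bullet> x)\<^sup>2) \<le> u x"
proof -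
  define a b where "a = - ((1 + \<beta>) / \<beta>)" and "b = - ((2 + \<beta>) / \<beta>)"
  define X :: "(real \<times> (real^'n) \<times> (real^'n^'n)) set" where "X = {0<..} \<times> UNIV \<times> sym_matrices"
  obtain S' where S': "\<And>y. y \<in> UNIV \<times> sym_matrices \<Longrightarrow>
      (S has_derivative blinfun_apply (S' y)) (at y within UNIV \<times> sym_matrices)"
    and contS': "continuous_on (UNIV \<times> sym_matrices) S'"
    using C1 unfolding C1_on_def by blast
  note so_v = C2_on_second_order[OF v_C2 open_ball]
  have open_punctured: "open (ball 0 R - {0::real^'n})"
    by (intro open_Diff) auto
  note so_u = C2_on_second_order[OF u_C2 open_punctured]
  define J where "J = (\<lambda>x. (v x, gradient v x, hessian v x))"
  have J_in: "J x \<in> X" if "x \<in> ball 0 R" for x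
    using v_pos hessian_in_sym_matrices[OF v_C2 open_ball] that by (auto simp: J_def X_def)
  have J0: "J 0 \<in> X"
    using R by (intro J_in) auto
  obtain K where K: "S' (scaled a b (J 0)) (scaled_derivative a b (J 0) (0, e, (2 * K) *\<^sub>R outer e)) < 0"
    using J0 unfolding J_def X_def by (auto intro: decreasing_direction[OF S' elliptic _ _ e])
  define Q where "Q = (2 * K) *\<^sub>R outer e"
  have Q: "Q \<in> sym_matrices"
    by (simp add: Q_def subspace_scale[OF subspace_sym_matrices] outer_in_sym_matrices)
  have Q_mult: "Q *v h = (2 * K * (e \<bullet> h)) *\<^sub>R e" for h
    by (simp add: Q_def outer_mult flip: scaleR_matrix_vector_assoc)
  obtain \<eta> where \<eta>: "\<eta> > 0"
    and decrease: "\<And>z d \<epsilon>. z \<in> X \<Longrightarrow> d \<in> UNIV \<times> UNIV \<times> sym_matrices \<Longrightarrow> dist z (J 0) < \<eta> \<Longrightarrow>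
        dist d (0, e, Q) < \<eta> \<Longrightarrow> 0 < \<epsilon> \<Longrightarrow> \<epsilon> < \<eta> \<Longrightarrow>
        z + \<epsilon> *\<^sub>R d \<in> X \<and> S (scaled a b (z + \<epsilon> *\<^sub>R d)) < S (scaled a b z)"
    using strict_decrease_near[OF S' contS', of "J 0" "(0, e, Q)" a b] J0 K Q
    unfolding X_def Q_def by auto
  define \<phi> where "\<phi> = (\<lambda>x. 0 + e \<bullet> x + K * (e \<bullet> x)\<^sup>2 + 0 * (x \<bullet> x))"
  define \<gamma> where "\<gamma> = (\<lambda>x. e + (2 * K * (e \<bullet> x)) *\<^sub>R e + (2 * 0) *\<^sub>R x)"
  have so_\<phi>: "second_order_on \<phi> \<gamma> (\<lambda>x h. Q *v h) Y" for Y
    using quadratic_second_order[of 0 e K e 0 Y] by (simp add: \<phi>_def \<gamma>_def Q_mult)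
  obtain r where r: "0 < r" "r < R"
    and near: "\<And>x. x \<noteq> 0 \<Longrightarrow> norm x \<le> r \<Longrightarrow> dist (J x) (J 0) < \<eta> \<and> \<bar>\<phi> x\<bar> < \<eta> / 4 \<and> dist (\<gamma> x) e < \<eta> / 4"
  proof -
    have "continuous_on (ball 0 R) J"
      unfolding J_def using so_v second_order_on_continuous by (intro continuous_on_Pair) auto
    then have "(J \<longlongrightarrow> J 0) (at 0)"
      using R by (simp add: continuous_on_eq_continuous_at continuous_at)
    then have "\<forall>\<^sub>F x in at 0. dist (J x) (J 0) < \<eta>"
      using \<eta> by (rule tendstoD)
    moreover have "(\<phi> \<longlongrightarrow> \<phi> 0) (at 0)"
      unfolding \<phi>_def by (intro tendsto_intros)
    then have "\<forall>\<^sub>F x in at 0. dist (\<phi> x) (\<phi> 0) < \<eta> / 4"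
      using \<eta> by (intro tendstoD) auto
    moreover have "(\<gamma> \<longlongrightarrow> \<gamma> 0) (at 0)"
      unfolding \<gamma>_def by (intro tendsto_intros)
    then have "\<forall>\<^sub>F x in at 0. dist (\<gamma> x) (\<gamma> 0) < \<eta> / 4"
      using \<eta> by (intro tendstoD) auto
    ultimately have "\<forall>\<^sub>F x in at 0. dist (J x) (J 0) < \<eta> \<and> \<bar>\<phi> x\<bar> < \<eta> / 4 \<and> dist (\<gamma> x) e < \<eta> / 4"
      by eventually_elim (simp add: \<phi>_def \<gamma>_def)
    then obtain d where "d > 0"
      and "\<And>x. x \<noteq> 0 \<Longrightarrow> norm x < d \<Longrightarrow> dist (J x) (J 0) < \<eta> \<and> \<bar>\<phi> x\<bar> < \<eta> / 4 \<and> dist (\<gamma> x) e < \<eta> / 4"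
      unfolding eventually_at by (auto simp: dist_norm)
    then show ?thesis
      using R by (intro that[of "min d R / 2"]) auto
  qed
  have cont_u: "continuous_on (ball 0 R - {0}) u" and cont_v: "continuous_on (ball 0 R) v"
    using so_u(1) so_v(1) second_order_on_continuous by blast+
  obtain c where c: "c > 0" "\<And>x. norm x = r \<Longrightarrow> c \<le> u x - v x"
  proof -
    have "continuous_on (sphere 0 r) (\<lambda>x. u x - v x)"
      by (intro continuous_on_diff continuous_on_subset[OF cont_u] continuous_on_subset[OF cont_v]) (use r in auto)
    moreover have "sphere (0::real^'n) r \<noteq> {}"
      using r by simp
    ultimately obtain y where y: "y \<in> sphere 0 r" "\<And>x. x \<in> sphere 0 r \<Longrightarrow> u y - v y \<le> u x - v x"
      using continuous_attains_inf[of "sphere 0 r" "\<lambda>x. u x - v x"] by auto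
    then show ?thesis
      using u_gt_v[of y] r by (intro that[of "u y - v y"]) auto
  qed
  define \<epsilon> where "\<epsilon> = min (\<eta> / 2) (c / \<eta>)"
  have \<epsilon>: "0 < \<epsilon>" "\<epsilon> < \<eta>" "\<epsilon> * (\<eta> / 4) < c"
  proof -
    show "0 < \<epsilon>" "\<epsilon> < \<eta>"
      using \<eta> c by (auto simp: \<epsilon>_def)
    have "\<epsilon> * (\<eta> / 4) \<le> c / \<eta> * (\<eta> / 4)"
      using \<eta> by (intro mult_right_mono) (auto simp: \<epsilon>_def)
    also have "\<dots> < c"
      using \<eta> c by simp
    finally show "\<epsilon> * (\<eta> / 4) < c" .
  qed
  define W where "W = (\<lambda>x. u x - (v x + \<epsilon> * \<phi> x))"
  have so_W: "second_order_on W (\<lambda>x. gradient u x - (gradient v x + \<epsilon> *\<^sub>R \<gamma> x))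
      (\<lambda>x h. hessian u x *v h - (hessian v x *v h + \<epsilon> *\<^sub>R (Q *v h))) (ball 0 R - {0})"
    unfolding W_def
    by (intro second_order_on_diff second_order_on_add second_order_on_scale so_u(1) so_\<phi>
        second_order_on_subset[OF so_v(1)]) auto
  have W_nonneg: "0 \<le> W x" if x: "x \<noteq> 0" "norm x \<le> r" for x
  proof (rule ccontr)
    assume "\<not> 0 \<le> W x"
    then have neg: "W x < 0" by simp
    have W_ge: "- (\<epsilon> * \<phi> y) < W y" if "y \<noteq> 0" "norm y \<le> r" for y
      using u_gt_v[of y] that r by (simp add: W_def)
    have cont_W: "continuous_on (cball 0 r - {0}) W"
      by (rule continuous_on_subset[OF second_order_on_continuous[OF so_W]]) (use r in auto)
    have sphere_W: "0 \<le> W y" if y: "norm y = r" for y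
    proof -
      have "\<bar>\<phi> y\<bar> < \<eta> / 4"
        using near[of y] y r by auto
      then have "\<epsilon> * \<phi> y \<le> \<epsilon> * (\<eta> / 4)"
        using \<epsilon>(1) by (intro mult_left_mono) auto
      then show ?thesis
        using c(2)[OF y] \<epsilon>(3) by (simp add: W_def)
    qed
    have near0: "\<forall>\<^sub>F y in at 0. W x < W y"
    proof -
      have "((\<lambda>y. - (\<epsilon> * \<phi> y)) \<longlongrightarrow> - (\<epsilon> * \<phi> 0)) (at 0)"
        unfolding \<phi>_def by (intro tendsto_intros)
      then have "\<forall>\<^sub>F y in at 0. W x < - (\<epsilon> * \<phi> y)"
        by (rule order_tendstoD) (use neg in \<open>simp add: \<phi>_def\<close>)
      moreover have "\<forall>\<^sub>F y in at 0. y \<noteq> 0 \<and> norm y \<le> r"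
        using r by (auto simp: eventually_at intro!: exI[of _ r])
      ultimately show ?thesis
      proof eventually_elim
        case (elim y)
        then show ?case using W_ge[of y] by linarith
      qed
    qed
    obtain y where y: "0 < norm y" "norm y < r" "W y < 0"
      and y_min: "\<And>z. z \<noteq> 0 \<Longrightarrow> norm z \<le> r \<Longrightarrow> W y \<le> W z"
      using punctured_ball_negative_minimum[OF cont_W sphere_W x neg near0] by blast
    have yB: "y \<in> ball 0 r - {0}" "y \<in> ball 0 R - {0}" "y \<in> ball 0 R"
      using y r by auto
    have open_r: "open (ball 0 r - {0::real^'n})"
      by (intro open_Diff) auto
    have so_Wr: "second_order_on W (\<lambda>x. gradient u x - (gradient v x + \<epsilon> *\<^sub>R \<gamma> x))
      (\<lambda>x h. hessian u x *v h - (hessian v x *v h + \<epsilon> *\<^sub>R (Q *v h))) (ball 0 r - {0})"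
      by (rule second_order_on_subset[OF so_W]) (use r in auto)
    have y_min': "W y \<le> W z" if "z \<in> ball 0 r - {0}" for z
      using y_min[of z] that by auto
    have grad: "gradient u y = gradient v y + \<epsilon> *\<^sub>R \<gamma> y"
      using local_min_second_order(1)[OF so_Wr open_r yB(1) y_min'] by simp
    define N where "N = hessian u y - (hessian v y + \<epsilon> *\<^sub>R Q)"
    have Hu: "hessian u y \<in> sym_matrices" and Hv: "hessian v y \<in> sym_matrices"
      using hessian_in_sym_matrices[OF u_C2 open_punctured yB(2)] hessian_in_sym_matrices[OF v_C2 open_ball yB(3)] .
    have HvQ: "hessian v y + \<epsilon> *\<^sub>R Q \<in> sym_matrices"
      by (intro subspace_add[OF subspace_sym_matrices] subspace_scale[OF subspace_sym_matrices] Hv Q)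
    have N: "N \<in> sym_matrices"
      unfolding N_def by (intro subspace_diff[OF subspace_sym_matrices] Hu HvQ)
    have N_psd: "0 \<le> h \<bullet> (N *v h)" for h
      using local_min_second_order(2)[OF so_Wr open_r yB(1) y_min', of h]
      by (simp add: N_def matrix_vector_mult_diff_rdistrib matrix_vector_mult_add_rdistrib inner_commute
          flip: scaleR_matrix_vector_assoc)
    \<comment> \<open>In these terms the touching function v + \<epsilon> \<phi> + W y has at y the value v y + \<epsilon> s.\<close>
    define s where "s = \<phi> y + W y / \<epsilon>"
    define d where "d = (s, \<gamma> y, Q)"
    have near_y: "dist (J y) (J 0) < \<eta>" "\<bar>\<phi> y\<bar> < \<eta> / 4" "dist (\<gamma> y) e < \<eta> / 4"
      using near[of y] y by auto
    have "- \<phi> y < W y / \<epsilon>" "W y / \<epsilon> < 0"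
      using W_ge[of y] y \<epsilon>(1) by (auto simp: field_simps)
    then have s: "\<bar>s\<bar> < \<eta> / 4"
      using near_y(2) unfolding s_def by linarith
    have d_near: "dist d (0, e, Q) < \<eta>"
    proof -
      have "dist d (0, e, Q) \<le> dist s 0 + dist (\<gamma> y, Q) (e, Q)"
        unfolding d_def dist_Pair_Pair[of s] by (intro sqrt_sum_squares_le_sum) auto
      also have "dist (\<gamma> y, Q) (e, Q) = dist (\<gamma> y) e"
        by (simp add: dist_Pair_Pair)
      finally show ?thesis
        using s near_y(3) \<eta> by simp
    qed
    have uy: "u y = v y + \<epsilon> * s"
      using \<epsilon>(1) by (simp add: s_def W_def field_simps)
    have "T_op S \<beta> (u y) (gradient u y) (hessian u y)
      = T_op S \<beta> (u y) (gradient u y) ((hessian v y + \<epsilon> *\<^sub>R Q) + N)"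
      by (simp add: N_def)
    also have "\<dots> \<le> T_op S \<beta> (u y) (gradient u y) (hessian v y + \<epsilon> *\<^sub>R Q)"
      by (rule T_op_antimono[OF C1 elliptic HvQ N N_psd])
    also have "\<dots> = S (scaled a b (J y + \<epsilon> *\<^sub>R d))"
      by (simp add: T_op_scaled a_def b_def J_def d_def uy grad)
    also have "\<dots> < S (scaled a b (J y))"
      using decrease[OF J_in[OF yB(3)] _ near_y(1) d_near \<epsilon>(1,2)] Q by (simp add: d_def)
    also have "\<dots> \<le> 0"
      using Tv[OF yB(2)] by (simp add: T_op_scaled a_def b_def J_def)
    finally show False
      using Tu[OF yB(2)] by simp
  qed
  show ?thesis
  proof (rule that[OF r \<epsilon>(1)])
    show "v x + \<epsilon> * (e \<bullet> x + K * (e \<bullet> x)\<^sup>2) \<le> u x" if "x \<in> ball 0 r - {0}" for x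
      using W_nonneg[of x] that by (simp add: W_def \<phi>_def)
  qed
qed

theorem corollary1p5:
  fixes S :: "(real^'n) \<times> (real^'n^'n) \<Rightarrow> real"
    and \<beta> :: real
    and u v :: "real^'n \<Rightarrow> real"
  assumes dim: "CARD('n) \<ge> 2"
    and S_C1: "C1_on S (UNIV \<times> sym_matrices)"
    and S_elliptic: "\<And>p M. M \<in> sym_matrices \<Longrightarrow> positive_definite (- matrix_gradient S p M)"
    and \<beta>_nz: "\<beta> \<noteq> 0"
    and S_nonneg: "-1 < \<beta> \<and> \<beta> < 0 \<Longrightarrow> \<forall>p. S (p, 0) \<ge> 0"
    and u_C2: "C2_on u (ball 0 2 - {0})"
    and v_C2: "C2_on v (ball 0 2)"
    and v_pos: "\<And>x. x \<in> ball 0 2 \<Longrightarrow> v x > 0"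
    and u_gt_v: "\<And>x. x \<in> ball 0 2 - {0} \<Longrightarrow> u x > v x"
    and u_superharmonic: "\<And>x. x \<in> ball 0 2 - {0} \<Longrightarrow> laplacian u x \<le> 0"
    and Tu: "\<And>x. x \<in> ball 0 2 - {0} \<Longrightarrow> T_op S \<beta> (u x) (gradient u x) (hessian u x) \<ge> 0"
    and Tv: "\<And>x. x \<in> ball 0 2 - {0} \<Longrightarrow> T_op S \<beta> (v x) (gradient v x) (hessian v x) \<le> 0"
  shows "Liminf (at 0) (\<lambda>x. ereal (u x - v x)) > 0"
proof -
  \<comment> \<open>Any nonzero vector serves as the direction of the tilt.\<close>
  define e :: "real^'n" where "e = axis undefined 1"
  have e: "e \<noteq> 0"
    by (simp add: e_def)
  obtain K \<epsilon> r where r: "0 < r" "r < 2" and \<epsilon>: "\<epsilon> > 0"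
    and tilted: "\<And>x. x \<in> ball 0 r - {0} \<Longrightarrow> v x + \<epsilon> * (e \<bullet> x + K * (e \<bullet> x)\<^sup>2) \<le> u x"
    by (rule supersolution_above_tilted_subsolution[OF S_C1 S_elliptic _ u_C2 v_C2 v_pos u_gt_v Tu Tv e]) auto
  have "open (ball 0 2 - {0::real^'n})"
    by (intro open_Diff) auto
  note so_u = C2_on_second_order(1)[OF u_C2 this]
  have v_der: "(v has_derivative (\<lambda>h. gradient v 0 \<bullet> h)) (at 0)"
    using second_order_onD(1)[OF C2_on_second_order(1)[OF v_C2 open_ball]] by simp
  obtain \<kappa> where \<kappa>: "\<kappa> > 0" "\<forall>\<^sub>F x in at 0. v 0 + \<kappa> < u x"
  proof (rule superharmonic_above_two_gradients)
    show "second_order_on u (gradient u) (\<lambda>x h. hessian u x *v h) (ball 0 r - {0})"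
      by (rule second_order_on_subset[OF so_u]) (use r in auto)
    show "(\<Sum>b\<in>Basis. (hessian u x *v b) \<bullet> b) \<le> 0" if "x \<in> ball 0 r - {0}" for x
      using u_superharmonic[of x] that r by (simp add: laplacian_eq_sum_Basis)
    show "v x \<le> u x" if "x \<in> ball 0 r - {0}" for x
      using u_gt_v[of x] that r by simp
    show "((\<lambda>x. v x + \<epsilon> * (e \<bullet> x + K * (e \<bullet> x)\<^sup>2)) has_derivative (\<lambda>h. (gradient v 0 + \<epsilon> *\<^sub>R e) \<bullet> h)) (at 0)"
      by (rule has_derivative_eq_rhs, (rule derivative_intros v_der)+) (simp add: inner_add_left)
  qed (use dim r e \<epsilon> v_der tilted in auto)
  have "continuous_on (ball 0 2) v"
    by (rule second_order_on_continuous[OF C2_on_second_order(1)[OF v_C2 open_ball]])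
  then have "(v \<longlongrightarrow> v 0) (at 0)"
    by (simp add: continuous_on_eq_continuous_at continuous_at)
  then have "\<forall>\<^sub>F x in at 0. v x < v 0 + \<kappa> / 2"
    by (rule order_tendstoD) (use \<kappa> in simp)
  with \<kappa>(2) have "\<forall>\<^sub>F x in at 0. ereal (\<kappa> / 2) \<le> ereal (u x - v x)"
    by eventually_elim simp
  then have "ereal (\<kappa> / 2) \<le> Liminf (at 0) (\<lambda>x. ereal (u x - v x))"
    by (rule Liminf_bounded)
  moreover have "0 < ereal (\<kappa> / 2)"
    using \<kappa> by simp
  ultimately show ?thesis
    by (rule less_le_trans[rotated])
qed

end
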